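(* Let $\mathcal{T}=(G,A,B)$ be a nondegenerate triple factorisation of a finite group $G$ with $\mathrm{core}_G(A)=1$, and suppose that $H$ is a subgroup with $A<H<G$. Regard $G$ as a subgroup of $G_0\wr G_1$, where $G_0=H/\mathrm{core}_H(A)$ and $G_1=G/\mathrm{core}_G(H)$, via the embedding $\varphi$ described in the context. Then there are triple factorisations $\mathcal{T}_0$ for $G_0$, $\mathcal{T}_1$ for $G_1$ and $\mathcal{T}_0\wr\mathcal{T}_1$ for $G_0\wr G_1$ (namely those defined in the context) such that $\mathcal{T}_0$ is a quotient of $\mathcal{T}|_H$, $\mathcal{T}_1$ is a quotient of a lift of $\mathcal{T}$, $\mathcal{T}_0\wr\mathcal{T}_1$ is nondegenerate, and either (a) $\mathcal{T}_1$ is nondegenerate, or (b) the triple factorisations $\mathcal{T}_0$ and $\mathcal{T}_0\wr\mathcal{T}_1$ are both nondegenerate, and the restriction of $\mathcal{T}_0\wr\mathcal{T}_1$ to $G$ is a nondegenerate lift $(G,A,D)$ of $\mathcal{T}$.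
   Context: All groups are finite. A triple factorisation $(G,A,B)$ consists of a group $G$ and subgroups $A,B\le G$ with $G=ABA$; it is degenerate if $G=AB$ and nondegenerate otherwise. $\mathrm{core}_G(H)=\bigcap_{g\in G}H^g$. For $N\unlhd G$, the quotient of $\mathcal{T}=(G,A,B)$ modulo $N$ is $\mathcal{T}/N=(G/N,AN/N,BN/N)$. A lift of $\mathcal{T}$ is a triple factorisation $(G,C,D)$ with $A\leq C\leq G$, $B\leq D\leq G$. The restriction of $(G,A,B)$ to $H\leq G$ is $(G,A,B)|_H=(H,A\cap H,B\cap H)$. Setting: let $\Omega=\{Ag:g\in G\}$ with $G$ acting by right multiplication (faithfully, as $\mathrm{core}_G(A)=1$), $\alpha=A\in\Omega$, $\Delta=\alpha^H$, and $\Sigma=\{\Delta^g : g\in G\}=\{\Delta_1,\ldots,\Delta_\ell\}$ with $\Delta_1=\Delta$, $\ell=|G:H|$; this is a block system for $G$ and $H$ is the setwise stabiliser of $\Delta$. For $X\le G$ write $X^\Sigma$ for the permutation group induced on $\Sigma$, and for $X\leq H$ (and $x\in H$) write $X^\Delta$ ($x^\Delta$) for the group (permutation) induced on $\Delta$. Put $G_0=H^\Delta\cong H/\mathrm{core}_H(A)$, $A_0=A^\Delta$, $B_0=(B\cap H)^\Delta$, $G_1=G^\Sigma\cong G/\mathrm{core}_G(H)$, $A_1=H^\Sigma$, $B_1=B^\Sigma$, and $\mathcal{T}_0=(G_0,A_0,B_0)$, $\mathcal{T}_1=(G_1,A_1,B_1)$. Under these identifications $\mathcal{T}_0$ is $\mathcal{T}|_H$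 modulo $\mathrm{core}_H(A)$, and $\mathcal{T}_1$ is $(G,H,B)$ modulo $\mathrm{core}_G(H)$. The wreath product $W=G_0\wr G_1$ is $\mathrm{Fun}(\Sigma,G_0)\rtimes G_1$, where $\mathrm{Fun}(\Sigma,G_0)\cong G_0^\ell$ is the group of functions $\Sigma\to G_0$ under pointwise multiplication, acting on $\Delta\times\Sigma$ by $(\delta,\Delta_i)^{f\sigma}=(\delta^{f(\Delta_i)},\Delta_i^\sigma)$. Put $\hat A=(A_0\times G_0^{\ell-1})\rtimes A_1=\{f\sigma : f(\Delta_1)\in A_0,\ \sigma\in A_1\}$ and $\hat B=B_0\wr B_1=\{f\sigma : f(\Delta_i)\in B_0\text{ for all }i,\ \sigma\in B_1\}$; the wreath product of triples is $\mathcal{T}_0\wr\mathcal{T}_1=(W,\hat A,\hat B)$. Embedding: choose $t_1=1,t_2,\ldots,t_\ell\in G$ with $\Delta_1^{t_i}=\Delta_i$, all chosen in $B$ if $B_1$ is transitive on $\Sigma$. Define $\varphi:G\to W$ by $\varphi(g)=f_g\,g^\Sigma$, where $f_g(\Delta_i)=(t_i g t_j^{-1})^\Delta$ with $\Delta_j=\Delta_i^g$. This is a monomorphism, and $G$ is identified with $\varphi(G)\leq W$ (so $A=\hat A\cap G$, and $B\leq\hat B$ if $B_1$ is transitive). *)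

theory Defs
  imports "HOL-Algebra.Algebra"
begin

section \<open>Triple factorisations\<close>

definition core :: "'a monoid \<Rightarrow> 'a set \<Rightarrow> 'a set" where
  "core G H = (\<Inter>g\<in>carrier G. {inv\<^bsub>G\<^esub> g \<otimes>\<^bsub>G\<^esub> h \<otimes>\<^bsub>G\<^esub> g | h. h \<in> H})"

type_synonym 'a triple = "'a monoid \<times> 'a set \<times> 'a set"

text \<open>Finiteness is part of the definition because all groups are finite here.\<close>
fun triple_factorisation :: "'a triple \<Rightarrow> bool" where
  "triple_factorisation (G, A, B) \<longleftrightarrow>
     group G \<and> finite (carrier G) \<and> subgroup A G \<and> subgroup B G \<and>
     carrier G = A <#>\<^bsub>G\<^esub> B <#>\<^bsub>G\<^esub> A"

fun degenerate :: "'a triple \<Rightarrow> bool" where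
  "degenerate (G, A, B) \<longleftrightarrow> carrier G = A <#>\<^bsub>G\<^esub> B"

definition nondegenerate :: "'a triple \<Rightarrow> bool" where
  "nondegenerate T \<longleftrightarrow> triple_factorisation T \<and> \<not> degenerate T"

fun quotient_triple :: "'a triple \<Rightarrow> 'a set \<Rightarrow> 'a set triple" where
  "quotient_triple (G, A, B) N =
     (G Mod N, (\<lambda>x. N #>\<^bsub>G\<^esub> x) ` (A <#>\<^bsub>G\<^esub> N), (\<lambda>x. N #>\<^bsub>G\<^esub> x) ` (B <#>\<^bsub>G\<^esub> N))"

fun restrict_triple :: "'a triple \<Rightarrow> 'a set \<Rightarrow> 'a triple" where
  "restrict_triple (G, A, B) H = (G\<lparr>carrier := H\<rparr>, A \<inter> H, B \<inter> H)"

fun lift_of :: "'a triple \<Rightarrow> 'a triple \<Rightarrow> bool" where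
  "lift_of (G', C, D) (G, A, B) \<longleftrightarrow>
     triple_factorisation (G, A, B) \<and> triple_factorisation (G', C, D) \<and>
     G' = G \<and> A \<subseteq> C \<and> B \<subseteq> D"

fun triple_iso :: "('a \<Rightarrow> 'b) \<Rightarrow> 'a triple \<Rightarrow> 'b triple \<Rightarrow> bool" where
  "triple_iso \<psi> (G, A, B) (G', A', B') \<longleftrightarrow> \<psi> \<in> iso G G' \<and> \<psi> ` A = A' \<and> \<psi> ` B = B'"

text \<open>\<open>T'\<close> is the quotient of \<open>T\<close> modulo \<open>N\<close>, up to the identification \<open>\<psi>\<close> of \<open>G/N\<close> with the
  group of \<open>T'\<close>.\<close>
definition is_quotient_of :: "('a set \<Rightarrow> 'b) \<Rightarrow> 'b triple \<Rightarrow> 'a triple \<Rightarrow> 'a set \<Rightarrow> bool" where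
  "is_quotient_of \<psi> T' T N \<longleftrightarrow>
     triple_factorisation T \<and> normal N (fst T) \<and> triple_iso \<psi> (quotient_triple T N) T'"


section \<open>Induced permutation groups\<close>

text \<open>Actions are on the right: in a product of permutations the left factor is applied first.\<close>
definition perm_group :: "'c set \<Rightarrow> ('c \<Rightarrow> 'c) set \<Rightarrow> ('c \<Rightarrow> 'c) monoid" where
  "perm_group \<Omega> P = \<lparr>carrier = P, monoid.mult = (\<lambda>\<sigma> \<tau>. compose \<Omega> \<tau> \<sigma>), monoid.one = (\<lambda>\<omega>\<in>\<Omega>. \<omega>)\<rparr>"

definition transitive_on :: "'c set \<Rightarrow> ('c \<Rightarrow> 'c) set \<Rightarrow> bool" where
  "transitive_on \<Omega> P \<longleftrightarrow> (\<forall>\<omega>\<in>\<Omega>. \<forall>\<omega>'\<in>\<Omega>. \<exists>\<sigma>\<in>P. \<sigma> \<omega> = \<omega>')"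

text \<open>The point \<open>\<alpha> = A\<close> is a right coset of \<open>A\<close>; \<open>block\<close> is its orbit \<open>\<Delta>\<close> under \<open>H\<close>, and
  \<open>blocks\<close> is the set \<open>\<Sigma>\<close> of all translates of \<open>\<Delta>\<close>.\<close>
definition block :: "'a monoid \<Rightarrow> 'a set \<Rightarrow> 'a set \<Rightarrow> 'a set set" where
  "block G A H = (\<lambda>h. A #>\<^bsub>G\<^esub> h) ` H"

definition translate :: "'a monoid \<Rightarrow> 'a set set \<Rightarrow> 'a \<Rightarrow> 'a set set" where
  "translate G \<Gamma> g = (\<lambda>\<delta>. \<delta> #>\<^bsub>G\<^esub> g) ` \<Gamma>"

definition blocks :: "'a monoid \<Rightarrow> 'a set \<Rightarrow> 'a set \<Rightarrow> 'a set set set" where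
  "blocks G A H = translate G (block G A H) ` carrier G"

definition on_points :: "'a monoid \<Rightarrow> 'a set \<Rightarrow> 'a set \<Rightarrow> 'a \<Rightarrow> 'a set \<Rightarrow> 'a set" where
  "on_points G A H x = (\<lambda>\<delta>\<in>block G A H. \<delta> #>\<^bsub>G\<^esub> x)"

definition on_blocks :: "'a monoid \<Rightarrow> 'a set \<Rightarrow> 'a set \<Rightarrow> 'a \<Rightarrow> 'a set set \<Rightarrow> 'a set set" where
  "on_blocks G A H x = (\<lambda>\<Gamma>\<in>blocks G A H. translate G \<Gamma> x)"

definition triple0 :: "'a monoid \<Rightarrow> 'a set \<Rightarrow> 'a set \<Rightarrow> 'a set \<Rightarrow> ('a set \<Rightarrow> 'a set) triple" where
  "triple0 G A B H =
     (perm_group (block G A H) (on_points G A H ` H),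
      on_points G A H ` A,
      on_points G A H ` (B \<inter> H))"

definition triple1 :: "'a monoid \<Rightarrow> 'a set \<Rightarrow> 'a set \<Rightarrow> 'a set \<Rightarrow> ('a set set \<Rightarrow> 'a set set) triple" where
  "triple1 G A B H =
     (perm_group (blocks G A H) (on_blocks G A H ` carrier G),
      on_blocks G A H ` H,
      on_blocks G A H ` B)"


section \<open>Wreath products\<close>

text \<open>The pair \<open>(f, \<sigma>)\<close> stands for \<open>f\<sigma>\<close>, which acts by
  \<open>(\<delta>, \<omega>)\<^sup>f\<^sup>\<sigma> = (\<delta>\<^sup>f\<^sup>(\<^sup>\<omega>\<^sup>), \<omega>\<^sup>\<sigma>)\<close>; applying \<open>f\<sigma>\<close> and then \<open>f'\<sigma>'\<close> gives the multiplication below.\<close>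
definition wreath :: "'g monoid \<Rightarrow> 'c set \<Rightarrow> ('c \<Rightarrow> 'c) monoid \<Rightarrow> (('c \<Rightarrow> 'g) \<times> ('c \<Rightarrow> 'c)) monoid" where
  "wreath G0 \<Omega> G1 =
     \<lparr>carrier = (\<Omega> \<rightarrow>\<^sub>E carrier G0) \<times> carrier G1,
      monoid.mult = (\<lambda>(f, \<sigma>) (f', \<sigma>'). ((\<lambda>\<omega>\<in>\<Omega>. f \<omega> \<otimes>\<^bsub>G0\<^esub> f' (\<sigma> \<omega>)), \<sigma> \<otimes>\<^bsub>G1\<^esub> \<sigma>')),
      monoid.one = ((\<lambda>\<omega>\<in>\<Omega>. \<one>\<^bsub>G0\<^esub>), \<one>\<^bsub>G1\<^esub>)\<rparr>"

text \<open>\<open>\<omega>\<^sub>1\<close> is the distinguished point of \<open>\<Omega>\<close>, namely \<open>\<Delta>\<^sub>1\<close> when \<open>\<Omega> = \<Sigma>\<close>.\<close>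
fun wreath_triple :: "'c set \<Rightarrow> 'c \<Rightarrow> 'g triple \<Rightarrow> ('c \<Rightarrow> 'c) triple \<Rightarrow> (('c \<Rightarrow> 'g) \<times> ('c \<Rightarrow> 'c)) triple" where
  "wreath_triple \<Omega> \<omega>\<^sub>1 (G0, A0, B0) (G1, A1, B1) =
     (wreath G0 \<Omega> G1,
      {(f, \<sigma>). f \<in> \<Omega> \<rightarrow>\<^sub>E carrier G0 \<and> f \<omega>\<^sub>1 \<in> A0 \<and> \<sigma> \<in> A1},
      {(f, \<sigma>). f \<in> \<Omega> \<rightarrow>\<^sub>E B0 \<and> \<sigma> \<in> B1})"


section \<open>The embedding into the wreath product\<close>

text \<open>A choice of the elements \<open>t\<^sub>i\<close>, indexed by the block \<open>\<Delta>\<^sub>i\<close> instead of \<open>i\<close>.\<close>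
definition transversal :: "'a monoid \<Rightarrow> 'a set \<Rightarrow> 'a set \<Rightarrow> 'a set \<Rightarrow> ('a set set \<Rightarrow> 'a) \<Rightarrow> bool" where
  "transversal G A B H t \<longleftrightarrow>
     t (block G A H) = \<one>\<^bsub>G\<^esub> \<and>
     (\<forall>\<Gamma>\<in>blocks G A H. t \<Gamma> \<in> carrier G \<and> translate G (block G A H) (t \<Gamma>) = \<Gamma>) \<and>
     (transitive_on (blocks G A H) (on_blocks G A H ` B) \<longrightarrow> (\<forall>\<Gamma>\<in>blocks G A H. t \<Gamma> \<in> B))"

definition embedding ::
  "'a monoid \<Rightarrow> 'a set \<Rightarrow> 'a set \<Rightarrow> ('a set set \<Rightarrow> 'a) \<Rightarrow> 'a \<Rightarrow>
     ('a set set \<Rightarrow> 'a set \<Rightarrow> 'a set) \<times> ('a set set \<Rightarrow> 'a set set)" where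
  "embedding G A H t g =
     ((\<lambda>\<Gamma>\<in>blocks G A H. on_points G A H (t \<Gamma> \<otimes>\<^bsub>G\<^esub> g \<otimes>\<^bsub>G\<^esub> inv\<^bsub>G\<^esub> (t (translate G \<Gamma> g)))),
      on_blocks G A H g)"

lemma transversal_exists:
  assumes G: "group G" and A: "subgroup A G" and B: "subgroup B G" and H: "subgroup H G"
  shows "\<exists>t. transversal G A B H t"
proof -
  let ?D = "block G A H" and ?S = "blocks G A H"
  let ?tr = "transitive_on ?S (on_blocks G A H ` B)"
  have sub: "\<delta> \<subseteq> carrier G" if "\<delta> \<in> ?D" for \<delta>
    using that G A H unfolding block_def
    by (auto dest!: subgroup.subset simp: group.is_monoid monoid.m_closed r_coset_def subset_iff)
  have one: "translate G ?D \<one>\<^bsub>G\<^esub> = ?D"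
    using sub G by (simp add: translate_def group.coset_mult_one cong: image_cong)
  have D: "?D \<in> ?S"
    using one G unfolding blocks_def
    by (metis image_eqI group.is_monoid monoid.one_closed)
  have "\<exists>x. x \<in> carrier G \<and> translate G ?D x = \<Gamma> \<and> (?tr \<longrightarrow> x \<in> B) \<and> (\<Gamma> = ?D \<longrightarrow> x = \<one>\<^bsub>G\<^esub>)"
    if \<Gamma>: "\<Gamma> \<in> ?S" for \<Gamma>
  proof (cases "\<Gamma> = ?D")
    case True
    then show ?thesis
      using one G B by (metis group.is_monoid monoid.one_closed subgroup.one_closed)
  next
    case False
    show ?thesis
    proof (cases ?tr)
      case True
      then obtain b where "b \<in> B" "on_blocks G A H b ?D = \<Gamma>"
        using D \<Gamma> unfolding transitive_on_def by blast
      then show ?thesis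
        using False D B by (auto simp: on_blocks_def dest: subgroup.mem_carrier)
    next
      case False
      then show ?thesis
        using \<open>\<Gamma> \<noteq> ?D\<close> \<Gamma> unfolding blocks_def by auto
    qed
  qed
  then obtain t where "\<forall>\<Gamma>\<in>?S. t \<Gamma> \<in> carrier G \<and> translate G ?D (t \<Gamma>) = \<Gamma> \<and>
      (?tr \<longrightarrow> t \<Gamma> \<in> B) \<and> (\<Gamma> = ?D \<longrightarrow> t \<Gamma> = \<one>\<^bsub>G\<^esub>)"
    by metis
  then show ?thesis
    using D unfolding transversal_def by blast
qed

end

theory Submission
  imports Defs
begin

text \<open>
  Write \<open>\<Delta>\<close> for the block of \<open>A\<close> and \<open>\<Sigma>\<close> for the block system. The group \<open>H\<close> acts transitively on
  \<open>\<Delta>\<close> with point stabiliser \<open>A\<close>, and \<open>G\<close> acts transitively on \<open>\<Sigma>\<close> with point stabiliser \<open>H\<close>. Both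
  situations are instances of \<open>transitive_action\<close>: the kernel of a transitive action is the core of
  the point stabiliser, so the induced triple is a quotient modulo that core
  (\<open>induced_is_quotient\<close>); and since the kernel lies in the stabiliser, which is the first factor,
  the passage to the induced triple neither creates nor destroys degeneracy
  (\<open>induced_degenerate_imp_degenerate\<close> is the direction that matters). Hence \<open>T\<^sub>0\<close> is degenerate only
  if \<open>H = A (B \<inter> H)\<close>, and \<open>T\<^sub>1\<close> only if \<open>G = H B\<close>.

  Everything rests on the remark that both cannot happen: \<open>G = H B = A (B \<inter> H) B = A B\<close> contradicts
  the nondegeneracy of \<open>T\<close> (\<open>degenerate_trans\<close>). Let \<open>(W, A', B')\<close> be \<open>T\<^sub>0 wr T\<^sub>1\<close>. The subgroup
  \<open>A'\<close> is constrained in the base group only at the coordinate \<open>\<Delta>\<close>, which its top part fixes. The other coordinates are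
  therefore no obstacle to a factorisation \<open>A' B' A'\<close> (\<open>wreath_triple_factorisation\<close>), while reading
  off the coordinate \<open>\<Delta>\<close> and the top part of a factorisation \<open>A' B'\<close> shows that a degenerate wreath
  product has both factors degenerate (\<open>wreath_degenerate_imp\<close>). So \<open>T\<^sub>0 wr T\<^sub>1\<close> is nondegenerate.

  If \<open>T\<^sub>1\<close> is degenerate, then \<open>T\<^sub>0\<close> is not, and \<open>G = H B\<close> makes \<open>B\<close> transitive on \<open>\<Sigma>\<close>. The
  representatives \<open>t\<^sub>i\<close> then lie in \<open>B\<close>, so the embedding \<open>\<phi>\<close> maps \<open>B\<close> into \<open>B'\<close>, and
  \<open>D = \<phi>\<^sup>-\<^sup>1(B')\<close> contains \<open>B\<close>, while \<open>\<phi>\<^sup>-\<^sup>1(A') = A\<close>. Because \<open>t\<^sub>1 = 1\<close>, the coordinate \<open>\<Delta>\<close> of \<open>\<phi>(h)\<close>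
  for \<open>h\<close> in \<open>H\<close> is the permutation that \<open>h\<close> induces on \<open>\<Delta>\<close>; so \<open>G = A D\<close> would make \<open>T\<^sub>0\<close> degenerate
  (\<open>degenerate_lift_imp_degenerate_points\<close>).
\<close>

section \<open>Lifts and restrictions\<close>

lemma triple_factorisation_mono:
  assumes T: "triple_factorisation (G, A, B)"
    and C: "subgroup C G" "A \<subseteq> C" and D: "subgroup D G" "B \<subseteq> D"
  shows "triple_factorisation (G, C, D)"
proof -
  interpret group G using T by simp
  have "carrier G \<subseteq> C <#>\<^bsub>G\<^esub> D <#>\<^bsub>G\<^esub> C"
    using T mono_set_mult[OF mono_set_mult[OF C(2) D(2)] C(2)] by simp
  moreover have "C <#>\<^bsub>G\<^esub> D <#>\<^bsub>G\<^esub> C \<subseteq> carrier G"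
    using C D by (intro set_mult_closed subgroup.subset)
  ultimately show ?thesis using T C D by auto
qed

text \<open>The middle factor of \<open>h = a b c\<close> is \<open>a\<^sup>-\<^sup>1 h c\<^sup>-\<^sup>1\<close>, hence already lies in \<open>H\<close> when \<open>A \<subseteq> H\<close>.\<close>
lemma triple_factorisation_restrict:
  assumes T: "triple_factorisation (G, A, B)" and H: "subgroup H G" and AH: "A \<subseteq> H"
  shows "triple_factorisation (G\<lparr>carrier := H\<rparr>, A, B \<inter> H)"
proof -
  interpret group G using T by simp
  have A: "subgroup A G" and B: "subgroup B G" using T by auto
  have "h \<in> A <#>\<^bsub>G\<^esub> (B \<inter> H) <#>\<^bsub>G\<^esub> A" if h: "h \<in> H" for h
  proof -
    have "h \<in> A <#>\<^bsub>G\<^esub> B <#>\<^bsub>G\<^esub> A"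
      using T subgroup.mem_carrier[OF H h] by simp
    then obtain a b c where abc: "a \<in> A" "b \<in> B" "c \<in> A" "h = a \<otimes>\<^bsub>G\<^esub> b \<otimes>\<^bsub>G\<^esub> c"
      by (auto simp: set_mult_def)
    have mem: "a \<in> carrier G" "b \<in> carrier G" "c \<in> carrier G"
      using abc A B by (auto dest: subgroup.mem_carrier)
    have "b = inv\<^bsub>G\<^esub> a \<otimes>\<^bsub>G\<^esub> h \<otimes>\<^bsub>G\<^esub> inv\<^bsub>G\<^esub> c"
      using mem by (simp add: abc(4) m_assoc) (simp flip: m_assoc)
    then have "b \<in> H"
      using abc(1,3) AH h H by (simp add: subgroup.m_closed subgroup.m_inv_closed subset_iff)
    with abc show ?thesis by (auto simp: set_mult_def)
  qed
  moreover have "A <#>\<^bsub>G\<^esub> (B \<inter> H) <#>\<^bsub>G\<^esub> A \<subseteq> H"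
    using AH H by (auto simp: set_mult_def subset_iff intro!: subgroup.m_closed)
  moreover have "subgroup A (G\<lparr>carrier := H\<rparr>)" "subgroup (B \<inter> H) (G\<lparr>carrier := H\<rparr>)"
    using subgroup_incl[OF A H AH] subgroup_incl[OF subgroups_Inter_pair[OF B H] H] by auto
  moreover have "finite H"
    using T H by (auto dest: subgroup.subset intro: finite_subset)
  ultimately show ?thesis
    using subgroup_imp_group[OF H] by auto
qed

text \<open>\<open>G = H B = A (B \<inter> H) B = A B\<close>. In contrapositive form: nondegeneracy of
  \<open>(G, A, B)\<close> passes to its restriction to \<open>H\<close> or to its lift \<open>(G, H, B)\<close>, if not to both.\<close>
lemma degenerate_trans:
  assumes G: "group G" and A: "subgroup A G" and B: "subgroup B G" and AH: "A \<subseteq> H"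
    and restrict: "degenerate (G\<lparr>carrier := H\<rparr>, A, B \<inter> H)" and lift: "degenerate (G, H, B)"
  shows "degenerate (G, A, B)"
proof -
  interpret group G by fact
  have "g \<in> A <#>\<^bsub>G\<^esub> B" if g: "g \<in> carrier G" for g
  proof -
    obtain h b where hb: "h \<in> H" "b \<in> B" "g = h \<otimes>\<^bsub>G\<^esub> b"
    proof -
      have "g \<in> H <#>\<^bsub>G\<^esub> B" using lift g by simp
      then show ?thesis using that by (auto simp: set_mult_def)
    qed
    then have "h \<in> A <#>\<^bsub>G\<^esub> (B \<inter> H)" using restrict by simp
    then obtain a b' where ab: "a \<in> A" "b' \<in> B" "h = a \<otimes>\<^bsub>G\<^esub> b'"
      by (auto simp: set_mult_def)
    have "g = a \<otimes>\<^bsub>G\<^esub> (b' \<otimes>\<^bsub>G\<^esub> b)"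
      using ab hb A B by (simp add: m_assoc subgroup.mem_carrier)
    then show ?thesis
      using ab hb B by (auto simp: set_mult_def intro: subgroup.m_closed)
  qed
  then show ?thesis
    using set_mult_closed[OF subgroup.subset[OF A] subgroup.subset[OF B]] by auto
qed

section \<open>Homomorphic images of triple factorisations\<close>

lemma (in group_hom) subgroup_preimage:
  assumes K: "subgroup K H"
  shows "subgroup {g \<in> carrier G. h g \<in> K} G"
proof (rule G.subgroupI)
  show "{g \<in> carrier G. h g \<in> K} \<noteq> {}"
    using subgroup.one_closed[OF K] hom_one G.one_closed by force
qed (use K in \<open>auto intro: subgroup.m_closed subgroup.m_inv_closed\<close>)

lemma triple_factorisation_hom_image:
  assumes T: "triple_factorisation (G, A, B)" and K: "group K"
    and \<theta>: "\<theta> \<in> hom G K" and onto: "\<theta> ` carrier G = carrier K"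
  shows "triple_factorisation (K, \<theta> ` A, \<theta> ` B)"
proof -
  interpret \<theta>: group_hom G K \<theta>
    using T K \<theta> by (simp add: group_hom_def group_hom_axioms_def)
  have A: "subgroup A G" and B: "subgroup B G" and ABA: "carrier G = A <#>\<^bsub>G\<^esub> B <#>\<^bsub>G\<^esub> A"
    using T by auto
  note sub = subgroup.subset[OF A] subgroup.subset[OF B]
  have "carrier K = \<theta> ` (A <#>\<^bsub>G\<^esub> B <#>\<^bsub>G\<^esub> A)"
    using onto ABA by simp
  also have "\<dots> = \<theta> ` A <#>\<^bsub>K\<^esub> \<theta> ` B <#>\<^bsub>K\<^esub> \<theta> ` A"
    using sub by (simp add: set_mult_hom[OF \<theta>] \<theta>.G.set_mult_closed)
  finally have "carrier K = \<theta> ` A <#>\<^bsub>K\<^esub> \<theta> ` B <#>\<^bsub>K\<^esub> \<theta> ` A" .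
  moreover have "finite (carrier K)"
    using T onto by (metis finite_imageI triple_factorisation.simps)
  ultimately show ?thesis
    using K A B \<theta>.subgroup_img_is_subgroup by simp
qed

text \<open>Nondegeneracy survives a quotient whose kernel lies in \<open>A\<close>: if \<open>\<theta> g = \<theta> a \<cdot> \<theta> b\<close> then
  \<open>g\<close> and \<open>a b\<close> differ by an element of the kernel, which \<open>A\<close> absorbs.\<close>
lemma degenerate_hom_image_imp_degenerate:
  assumes G: "group G" and A: "subgroup A G" and B: "subgroup B G" and K: "group K"
    and \<theta>: "\<theta> \<in> hom G K" and onto: "\<theta> ` carrier G = carrier K"
    and ker: "kernel G K \<theta> \<subseteq> A"
    and deg: "degenerate (K, \<theta> ` A, \<theta> ` B)"
  shows "degenerate (G, A, B)"
proof -
  interpret \<theta>: group_hom G K \<theta>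
    using G K \<theta> by (simp add: group_hom_def group_hom_axioms_def)
  have "g \<in> A <#>\<^bsub>G\<^esub> B" if g: "g \<in> carrier G" for g
  proof -
    obtain a b where ab: "a \<in> A" "b \<in> B" "\<theta> g = \<theta> a \<otimes>\<^bsub>K\<^esub> \<theta> b"
    proof -
      have "\<theta> g \<in> \<theta> ` A <#>\<^bsub>K\<^esub> \<theta> ` B"
        using deg \<theta>.hom_closed[OF g] by simp
      then show ?thesis using that by (auto simp: set_mult_def)
    qed
    have mem: "a \<in> carrier G" "b \<in> carrier G"
      using ab subgroup.mem_carrier A B by metis+
    define k where "k = g \<otimes>\<^bsub>G\<^esub> inv\<^bsub>G\<^esub> (a \<otimes>\<^bsub>G\<^esub> b)"
    have "k \<in> kernel G K \<theta>"
      using g mem ab(3) by (simp add: kernel_def k_def)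
    then have k: "k \<in> A" "k \<in> carrier G"
      using ker by (auto simp: kernel_def)
    have "g = (k \<otimes>\<^bsub>G\<^esub> a) \<otimes>\<^bsub>G\<^esub> b"
      using g mem k unfolding k_def by (simp add: \<theta>.G.m_assoc)
    then show ?thesis
      using ab k A by (auto simp: set_mult_def intro: subgroup.m_closed)
  qed
  then show ?thesis
    using \<theta>.G.set_mult_closed[OF subgroup.subset[OF A] subgroup.subset[OF B]]
    by auto
qed

text \<open>The triple obtained from an epimorphism with kernel \<open>N\<close> is the quotient modulo \<open>N\<close>, under the
  identification given by the first isomorphism theorem.\<close>
lemma hom_image_is_quotient:
  assumes T: "triple_factorisation (G, A, B)" and K: "group K"
    and \<theta>: "\<theta> \<in> hom G K" and onto: "\<theta> ` carrier G = carrier K"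
  shows "\<exists>\<psi>. (\<forall>g\<in>carrier G. \<psi> (kernel G K \<theta> #>\<^bsub>G\<^esub> g) = \<theta> g) \<and>
             is_quotient_of \<psi> (K, \<theta> ` A, \<theta> ` B) (G, A, B) (kernel G K \<theta>)"
proof -
  interpret \<theta>: group_hom G K \<theta>
    using T K \<theta> by (simp add: group_hom_def group_hom_axioms_def)
  let ?N = "kernel G K \<theta>" and ?\<psi> = "\<lambda>C. the_elem (\<theta> ` C)"
  have N: "?N \<subseteq> carrier G" "\<one>\<^bsub>G\<^esub> \<in> ?N"
    by (auto simp: kernel_def)
  have \<psi>: "?\<psi> (?N #>\<^bsub>G\<^esub> g) = \<theta> g" if "g \<in> carrier G" for g
  proof -
    have "\<theta> ` (?N #>\<^bsub>G\<^esub> g) = {\<theta> g}"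
      using that N by (fastforce simp: r_coset_def kernel_def)
    then show ?thesis by simp
  qed
  have img: "?\<psi> ` ((\<lambda>x. ?N #>\<^bsub>G\<^esub> x) ` (C <#>\<^bsub>G\<^esub> ?N)) = \<theta> ` C" if C: "C \<subseteq> carrier G" for C
  proof -
    have "?\<psi> ` ((\<lambda>x. ?N #>\<^bsub>G\<^esub> x) ` (C <#>\<^bsub>G\<^esub> ?N)) = \<theta> ` (C <#>\<^bsub>G\<^esub> ?N)"
      using \<psi> \<theta>.G.set_mult_closed[OF C N(1)] unfolding image_image by (intro image_cong) auto
    also have "\<dots> = \<theta> ` C <#>\<^bsub>K\<^esub> {\<one>\<^bsub>K\<^esub>}"
    proof -
      have "\<theta> ` ?N = {\<one>\<^bsub>K\<^esub>}" using N by (force simp: kernel_def)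
      then show ?thesis using set_mult_hom[OF \<theta> C N(1)] by simp
    qed
    also have "\<dots> = \<theta> ` C"
      using C by (force simp: set_mult_def)
    finally show ?thesis .
  qed
  have "A \<subseteq> carrier G" "B \<subseteq> carrier G"
    using T by (auto dest: subgroup.subset)
  then have "triple_iso ?\<psi> (quotient_triple (G, A, B) ?N) (K, \<theta> ` A, \<theta> ` B)"
    using \<theta>.FactGroup_iso_set[OF onto] by (simp add: img)
  then have "is_quotient_of ?\<psi> (K, \<theta> ` A, \<theta> ` B) (G, A, B) ?N"
    using T \<theta>.normal_kernel unfolding is_quotient_of_def fst_conv by blast
  with \<psi> show ?thesis
    by (intro exI[of _ ?\<psi>] conjI ballI)
qed

section \<open>Permutation groups induced by right actions\<close>

lemma perm_group_simps [simp]: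
  "carrier (perm_group \<Omega> P) = P"
  "\<sigma> \<otimes>\<^bsub>perm_group \<Omega> P\<^esub> \<tau> = compose \<Omega> \<tau> \<sigma>"
  "\<one>\<^bsub>perm_group \<Omega> P\<^esub> = (\<lambda>\<omega>\<in>\<Omega>. \<omega>)"
  by (simp_all add: perm_group_def)

locale right_action = group G for G :: "'a monoid" (structure) +
  fixes \<Omega> :: "'c set" and act :: "'c \<Rightarrow> 'a \<Rightarrow> 'c"
  assumes act_closed: "\<omega> \<in> \<Omega> \<Longrightarrow> g \<in> carrier G \<Longrightarrow> act \<omega> g \<in> \<Omega>"
    and act_mult: "\<omega> \<in> \<Omega> \<Longrightarrow> g \<in> carrier G \<Longrightarrow> h \<in> carrier G \<Longrightarrow>
      act \<omega> (g \<otimes> h) = act (act \<omega> g) h"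
    and act_one: "\<omega> \<in> \<Omega> \<Longrightarrow> act \<omega> \<one> = \<omega>"
begin

definition perm :: "'a \<Rightarrow> 'c \<Rightarrow> 'c" where
  "perm g = (\<lambda>\<omega>\<in>\<Omega>. act \<omega> g)"

abbreviation induced :: "('c \<Rightarrow> 'c) monoid" where
  "induced \<equiv> perm_group \<Omega> (perm ` carrier G)"

lemma perm_mult:
  assumes "g \<in> carrier G" "h \<in> carrier G"
  shows "perm (g \<otimes> h) = compose \<Omega> (perm h) (perm g)"
  using assms by (auto simp: perm_def compose_def act_closed act_mult)

lemma perm_one: "perm \<one> = (\<lambda>\<omega>\<in>\<Omega>. \<omega>)"
  by (auto simp: perm_def act_one)

lemma act_inv:
  assumes "\<omega> \<in> \<Omega>" "g \<in> carrier G"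
  shows "act (act \<omega> g) (inv g) = \<omega>" "act (act \<omega> (inv g)) g = \<omega>"
  using assms act_mult[of \<omega> g "inv g"] act_mult[of \<omega> "inv g" g] act_one by auto

lemma perm_hom: "perm \<in> hom G induced"
  by (auto simp: hom_def perm_group_def perm_mult)

lemma induced_group: "group induced"
proof -
  have "group (induced\<lparr>carrier := perm ` carrier G, one := perm \<one>\<rparr>)"
    by (rule hom_imp_img_group[OF perm_hom])
  then show ?thesis
    by (simp add: perm_group_def perm_one)
qed

lemma perm_onto: "perm ` carrier G = carrier induced"
  by (simp add: perm_group_def)

text \<open>In a wreath product the elements of the top group are themselves functions and act by
  evaluation; an induced permutation group qualifies as such a top group.\<close>
lemma induced_acts: "right_action induced \<Omega> (\<lambda>\<omega> \<sigma>. \<sigma> \<omega>)"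
proof (intro right_action.intro induced_group right_action_axioms.intro)
qed (auto simp: perm_group_def perm_def act_closed compose_def)

end

locale transitive_action = right_action G \<Omega> act
  for G :: "'a monoid" (structure) and \<Omega> :: "'c set" and act +
  fixes base :: 'c
  assumes orbit: "\<Omega> = act base ` carrier G" and base: "base \<in> \<Omega>"
begin

definition stab :: "'a set" where
  "stab = {g \<in> carrier G. act base g = base}"

text \<open>An element fixes the point \<open>base\<^sup>x\<close> exactly when it lies in the conjugate \<open>stab\<^sup>x\<close>, and every
  point has this form.\<close>
lemma kernel_perm: "kernel G induced perm = core G stab"
proof -
  have fix_iff: "act (act base x) k = act base x \<longleftrightarrow> x \<otimes> k \<otimes> inv x \<in> stab"
    if "x \<in> carrier G" "k \<in> carrier G" for x k
    using that base act_inv act_mult act_closed by (auto simp: stab_def) metis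
  have conj_iff: "k \<in> {inv x \<otimes> s \<otimes> x | s. s \<in> stab} \<longleftrightarrow> k \<in> carrier G \<and> x \<otimes> k \<otimes> inv x \<in> stab"
    if x: "x \<in> carrier G" for x k
  proof
    assume "k \<in> {inv x \<otimes> s \<otimes> x | s. s \<in> stab}"
    then obtain s where s: "s \<in> stab" "k = inv x \<otimes> s \<otimes> x" by blast
    then have "s \<in> carrier G" by (simp add: stab_def)
    with s x show "k \<in> carrier G \<and> x \<otimes> k \<otimes> inv x \<in> stab"
      by (simp add: m_assoc inv_solve_left) (simp flip: m_assoc)
  next
    assume k: "k \<in> carrier G \<and> x \<otimes> k \<otimes> inv x \<in> stab"
    then have "k = inv x \<otimes> (x \<otimes> k \<otimes> inv x) \<otimes> x"
      using x by (simp add: m_assoc) (simp flip: m_assoc)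
    with k show "k \<in> {inv x \<otimes> s \<otimes> x | s. s \<in> stab}" by blast
  qed
  have "k \<in> kernel G induced perm \<longleftrightarrow> k \<in> core G stab" for k
  proof -
    have "k \<in> kernel G induced perm \<longleftrightarrow> k \<in> carrier G \<and> (\<forall>\<omega>\<in>\<Omega>. act \<omega> k = \<omega>)"
      by (auto simp: kernel_def perm_group_def perm_def restrict_def fun_eq_iff)
    also have "\<dots> \<longleftrightarrow> k \<in> carrier G \<and> (\<forall>x\<in>carrier G. x \<otimes> k \<otimes> inv x \<in> stab)"
      using orbit fix_iff by auto
    also have "\<dots> \<longleftrightarrow> k \<in> core G stab"
      unfolding core_def using conj_iff by auto
    finally show ?thesis .
  qed
  then show ?thesis by blast
qed

lemma stab_subgroup: "subgroup stab G"
proof (rule subgroupI)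
  show "inv g \<in> stab" if "g \<in> stab" for g
    using that base act_inv by (auto simp: stab_def) metis
qed (use base in \<open>auto simp: stab_def act_one act_mult\<close>)

lemma core_stab_subset: "core G stab \<subseteq> stab"
proof
  fix k assume "k \<in> core G stab"
  then have "k \<in> carrier G" "perm k base = (\<lambda>\<omega>\<in>\<Omega>. \<omega>) base"
    unfolding kernel_perm[symmetric] by (auto simp: kernel_def perm_group_def)
  then show "k \<in> stab" using base by (simp add: perm_def stab_def)
qed

text \<open>Passing to the induced group loses nothing about the stabiliser, because whether an element
  fixes the base point can be read off from its permutation.\<close>
lemma perm_mem_perm_stab_iff:
  assumes "g \<in> carrier G"
  shows "perm g \<in> perm ` stab \<longleftrightarrow> g \<in> stab"
proof
  assume "perm g \<in> perm ` stab"
  then obtain s where "s \<in> stab" "perm g base = perm s base" by auto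
  then show "g \<in> stab" using assms base by (simp add: perm_def stab_def)
qed auto

lemma induced_triple_factorisation:
  assumes "triple_factorisation (G, stab, B)"
  shows "triple_factorisation (induced, perm ` stab, perm ` B)"
  using triple_factorisation_hom_image[OF assms induced_group perm_hom perm_onto] .

lemma induced_degenerate_imp_degenerate:
  assumes "subgroup B G" "degenerate (induced, perm ` stab, perm ` B)"
  shows "degenerate (G, stab, B)"
  using degenerate_hom_image_imp_degenerate[OF is_group stab_subgroup assms(1) induced_group perm_hom
      perm_onto _ assms(2)] core_stab_subset by (simp add: kernel_perm)

lemma induced_is_quotient:
  assumes "triple_factorisation (G, stab, B)"
  shows "\<exists>\<psi>. (\<forall>g\<in>carrier G. \<psi> (core G stab #> g) = perm g) \<and>
             is_quotient_of \<psi> (induced, perm ` stab, perm ` B) (G, stab, B) (core G stab)"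
  using hom_image_is_quotient[OF assms induced_group perm_hom perm_onto] by (simp add: kernel_perm)

end

section \<open>Wreath products of triple factorisations\<close>

text \<open>The top group acts on \<open>\<Omega>\<close> by evaluation, with the left factor of a product applied first.\<close>
locale wreath_product = G0: group G0 + right_action G1 \<Omega> "\<lambda>\<omega> \<sigma>. \<sigma> \<omega>"
  for G0 :: "'g monoid" and G1 :: "('c \<Rightarrow> 'c) monoid" and \<Omega> :: "'c set"
begin

lemma wreath_mult [simp]:
  "(f, \<sigma>) \<otimes>\<^bsub>wreath G0 \<Omega> G1\<^esub> (f', \<sigma>') =
     ((\<lambda>\<omega>\<in>\<Omega>. f \<omega> \<otimes>\<^bsub>G0\<^esub> f' (\<sigma> \<omega>)), \<sigma> \<otimes>\<^bsub>G1\<^esub> \<sigma>')"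
  by (simp add: wreath_def)

lemma wreath_carrier: "carrier (wreath G0 \<Omega> G1) = (\<Omega> \<rightarrow>\<^sub>E carrier G0) \<times> carrier G1"
  by (simp add: wreath_def)

lemma wreath_one: "\<one>\<^bsub>wreath G0 \<Omega> G1\<^esub> = ((\<lambda>\<omega>\<in>\<Omega>. \<one>\<^bsub>G0\<^esub>), \<one>\<^bsub>G1\<^esub>)"
  by (simp add: wreath_def)

lemma wreath_left_inverse:
  assumes f: "f \<in> \<Omega> \<rightarrow>\<^sub>E carrier G0" and \<sigma>: "\<sigma> \<in> carrier G1"
  shows "((\<lambda>\<omega>\<in>\<Omega>. inv\<^bsub>G0\<^esub> (f ((inv\<^bsub>G1\<^esub> \<sigma>) \<omega>))), inv\<^bsub>G1\<^esub> \<sigma>) \<otimes>\<^bsub>wreath G0 \<Omega> G1\<^esub> (f, \<sigma>)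
         = \<one>\<^bsub>wreath G0 \<Omega> G1\<^esub>"
proof -
  have "f ((inv\<^bsub>G1\<^esub> \<sigma>) \<omega>) \<in> carrier G0" if "\<omega> \<in> \<Omega>" for \<omega>
    using PiE_mem[OF f act_closed[OF that inv_closed[OF \<sigma>]]] .
  with \<sigma> show ?thesis
    by (auto simp: wreath_one intro!: restrict_ext)
qed

lemma wreath_group: "group (wreath G0 \<Omega> G1)"
proof (rule groupI)
  fix x y z
  assume "x \<in> carrier (wreath G0 \<Omega> G1)" "y \<in> carrier (wreath G0 \<Omega> G1)"
    "z \<in> carrier (wreath G0 \<Omega> G1)"
  then obtain f \<sigma> f' \<sigma>' f'' \<sigma>'' where [simp]: "x = (f, \<sigma>)" "y = (f', \<sigma>')" "z = (f'', \<sigma>'')"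
    and f: "f \<in> \<Omega> \<rightarrow>\<^sub>E carrier G0" "f' \<in> \<Omega> \<rightarrow>\<^sub>E carrier G0" "f'' \<in> \<Omega> \<rightarrow>\<^sub>E carrier G0"
    and \<sigma>: "\<sigma> \<in> carrier G1" "\<sigma>' \<in> carrier G1" "\<sigma>'' \<in> carrier G1"
    by (auto simp: wreath_carrier)
  have cl: "\<sigma> \<omega> \<in> \<Omega>" "\<sigma>' (\<sigma> \<omega>) \<in> \<Omega>" "(\<sigma> \<otimes>\<^bsub>G1\<^esub> \<sigma>') \<omega> = \<sigma>' (\<sigma> \<omega>)" if "\<omega> \<in> \<Omega>" for \<omega>
    using that act_closed[OF that \<sigma>(1)] act_closed[OF act_closed[OF that \<sigma>(1)] \<sigma>(2)]
      act_mult[OF that \<sigma>(1,2)] by auto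
  show "x \<otimes>\<^bsub>wreath G0 \<Omega> G1\<^esub> y \<in> carrier (wreath G0 \<Omega> G1)"
    using cl PiE_mem[OF f(1)] PiE_mem[OF f(2)] \<sigma> by (auto simp: wreath_carrier)
  show "x \<otimes>\<^bsub>wreath G0 \<Omega> G1\<^esub> y \<otimes>\<^bsub>wreath G0 \<Omega> G1\<^esub> z =
    x \<otimes>\<^bsub>wreath G0 \<Omega> G1\<^esub> (y \<otimes>\<^bsub>wreath G0 \<Omega> G1\<^esub> z)"
    using cl PiE_mem[OF f(1)] PiE_mem[OF f(2)] PiE_mem[OF f(3)] \<sigma>
    by (auto simp: G0.m_assoc m_assoc intro!: restrict_ext)
next
  show "\<one>\<^bsub>wreath G0 \<Omega> G1\<^esub> \<in> carrier (wreath G0 \<Omega> G1)"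
    by (auto simp: wreath_carrier wreath_one)
next
  fix x assume x: "x \<in> carrier (wreath G0 \<Omega> G1)"
  then obtain f \<sigma> where [simp]: "x = (f, \<sigma>)" and f: "f \<in> \<Omega> \<rightarrow>\<^sub>E carrier G0" and \<sigma>: "\<sigma> \<in> carrier G1"
    by (auto simp: wreath_carrier)
  have "(\<lambda>\<omega>\<in>\<Omega>. \<one>\<^bsub>G0\<^esub> \<otimes>\<^bsub>G0\<^esub> f (\<one>\<^bsub>G1\<^esub> \<omega>)) = f"
    by (rule extensionalityI[of _ \<Omega>]) (use f PiE_mem[OF f] act_one in \<open>auto simp: PiE_iff\<close>)
  then show "\<one>\<^bsub>wreath G0 \<Omega> G1\<^esub> \<otimes>\<^bsub>wreath G0 \<Omega> G1\<^esub> x = x"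
    using \<sigma> by (simp add: wreath_one cong: restrict_cong)
  show "\<exists>y\<in>carrier (wreath G0 \<Omega> G1). y \<otimes>\<^bsub>wreath G0 \<Omega> G1\<^esub> x = \<one>\<^bsub>wreath G0 \<Omega> G1\<^esub>"
  proof (intro bexI)
    show "((\<lambda>\<omega>\<in>\<Omega>. inv\<^bsub>G0\<^esub> (f ((inv\<^bsub>G1\<^esub> \<sigma>) \<omega>))), inv\<^bsub>G1\<^esub> \<sigma>) \<otimes>\<^bsub>wreath G0 \<Omega> G1\<^esub> x
         = \<one>\<^bsub>wreath G0 \<Omega> G1\<^esub>"
      using wreath_left_inverse[OF f \<sigma>] by (simp del: wreath_mult)
  qed (use \<sigma> PiE_mem[OF f act_closed[OF _ inv_closed[OF \<sigma>]]] in \<open>auto simp: wreath_carrier\<close>)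
qed

lemma wreath_inv:
  assumes f: "f \<in> \<Omega> \<rightarrow>\<^sub>E carrier G0" and \<sigma>: "\<sigma> \<in> carrier G1"
  shows "inv\<^bsub>wreath G0 \<Omega> G1\<^esub> (f, \<sigma>) =
    ((\<lambda>\<omega>\<in>\<Omega>. inv\<^bsub>G0\<^esub> (f ((inv\<^bsub>G1\<^esub> \<sigma>) \<omega>))), inv\<^bsub>G1\<^esub> \<sigma>)"
  using f \<sigma> PiE_mem[OF f act_closed[OF _ inv_closed[OF \<sigma>]]]
  by (intro group.inv_equality[OF wreath_group] wreath_left_inverse)
    (auto simp: wreath_carrier)

text \<open>That \<open>A1\<close> fixes \<open>\<omega>\<^sub>1\<close> is what makes this set closed: the coordinate \<open>\<omega>\<^sub>1\<close> of a product is then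
  the product of the coordinates \<open>\<omega>\<^sub>1\<close>.\<close>
lemma point_subgroup:
  assumes A0: "subgroup A0 G0" and A1: "subgroup A1 G1"
    and \<omega>\<^sub>1: "\<omega>\<^sub>1 \<in> \<Omega>" and fixes1: "\<forall>\<sigma>\<in>A1. \<sigma> \<omega>\<^sub>1 = \<omega>\<^sub>1"
  shows "subgroup {(f, \<sigma>). f \<in> \<Omega> \<rightarrow>\<^sub>E carrier G0 \<and> f \<omega>\<^sub>1 \<in> A0 \<and> \<sigma> \<in> A1} (wreath G0 \<Omega> G1)"
    (is "subgroup ?S ?W")
proof (rule group.subgroupI[OF wreath_group])
  show "?S \<subseteq> carrier ?W" using subgroup.mem_carrier[OF A1] by (auto simp: wreath_carrier)
  have "((\<lambda>\<omega>\<in>\<Omega>. \<one>\<^bsub>G0\<^esub>), \<one>\<^bsub>G1\<^esub>) \<in> ?S"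
    using \<omega>\<^sub>1 subgroup.one_closed[OF A0] subgroup.one_closed[OF A1] by auto
  then show "?S \<noteq> {}" by blast
next
  fix x assume "x \<in> ?S"
  then obtain f \<sigma> where [simp]: "x = (f, \<sigma>)" and f: "f \<in> \<Omega> \<rightarrow>\<^sub>E carrier G0" "f \<omega>\<^sub>1 \<in> A0"
    and \<sigma>: "\<sigma> \<in> A1" by blast
  have \<sigma>': "\<sigma> \<in> carrier G1" "inv\<^bsub>G1\<^esub> \<sigma> \<in> A1"
    using \<sigma> A1 by (auto dest: subgroup.mem_carrier subgroup.m_inv_closed)
  moreover have "(inv\<^bsub>G1\<^esub> \<sigma>) \<omega>\<^sub>1 = \<omega>\<^sub>1"
    using fixes1 \<sigma>'(2) by blast
  ultimately show "inv\<^bsub>?W\<^esub> x \<in> ?S"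
    using f \<omega>\<^sub>1 PiE_mem[OF f(1) act_closed[OF _ inv_closed[OF \<sigma>'(1)]]] subgroup.m_inv_closed[OF A0 f(2)]
    by (simp add: wreath_inv)
next
  fix x y assume "x \<in> ?S" "y \<in> ?S"
  then obtain f \<sigma> f' \<sigma>' where [simp]: "x = (f, \<sigma>)" "y = (f', \<sigma>')"
    and f: "f \<in> \<Omega> \<rightarrow>\<^sub>E carrier G0" "f \<omega>\<^sub>1 \<in> A0" and f': "f' \<in> \<Omega> \<rightarrow>\<^sub>E carrier G0" "f' \<omega>\<^sub>1 \<in> A0"
    and \<sigma>: "\<sigma> \<in> A1" "\<sigma>' \<in> A1" by blast
  moreover have "\<sigma> \<omega>\<^sub>1 = \<omega>\<^sub>1"
    using fixes1 \<sigma>(1) by blast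
  ultimately show "x \<otimes>\<^bsub>?W\<^esub> y \<in> ?S"
    using \<omega>\<^sub>1 PiE_mem[OF f(1)] PiE_mem[OF f'(1) act_closed[OF _ subgroup.mem_carrier[OF A1 \<sigma>(1)]]]
      subgroup.m_closed[OF A0 f(2) f'(2)] subgroup.m_closed[OF A1 \<sigma>] by simp
qed

lemma wreath_subgroup:
  assumes B0: "subgroup B0 G0" and B1: "subgroup B1 G1"
  shows "subgroup {(f, \<sigma>). f \<in> \<Omega> \<rightarrow>\<^sub>E B0 \<and> \<sigma> \<in> B1} (wreath G0 \<Omega> G1)"
    (is "subgroup ?S ?W")
proof (rule group.subgroupI[OF wreath_group])
  have PiE: "f \<in> \<Omega> \<rightarrow>\<^sub>E carrier G0" if "f \<in> \<Omega> \<rightarrow>\<^sub>E B0" for f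
    using that subgroup.subset[OF B0] by (auto simp: PiE_iff)
  show "?S \<subseteq> carrier ?W" using subgroup.mem_carrier[OF B1] PiE by (auto simp: wreath_carrier)
  have "((\<lambda>\<omega>\<in>\<Omega>. \<one>\<^bsub>G0\<^esub>), \<one>\<^bsub>G1\<^esub>) \<in> ?S"
    using subgroup.one_closed[OF B0] subgroup.one_closed[OF B1] by auto
  then show "?S \<noteq> {}" by blast
  show "inv\<^bsub>?W\<^esub> x \<in> ?S" if x: "x \<in> ?S" for x
  proof -
    from x obtain f \<sigma> where [simp]: "x = (f, \<sigma>)" and f: "f \<in> \<Omega> \<rightarrow>\<^sub>E B0" and \<sigma>: "\<sigma> \<in> B1"
      by blast
    have \<sigma>': "\<sigma> \<in> carrier G1" "inv\<^bsub>G1\<^esub> \<sigma> \<in> B1"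
      using \<sigma> B1 by (auto dest: subgroup.mem_carrier subgroup.m_inv_closed)
    then show ?thesis
      using PiE[OF f] PiE_mem[OF f act_closed[OF _ inv_closed[OF \<sigma>'(1)]]] subgroup.m_inv_closed[OF B0]
      by (simp add: wreath_inv)
  qed
next
  fix x y assume "x \<in> ?S" "y \<in> ?S"
  then obtain f \<sigma> f' \<sigma>' where [simp]: "x = (f, \<sigma>)" "y = (f', \<sigma>')"
    and f: "f \<in> \<Omega> \<rightarrow>\<^sub>E B0" and f': "f' \<in> \<Omega> \<rightarrow>\<^sub>E B0"
    and \<sigma>: "\<sigma> \<in> B1" "\<sigma>' \<in> B1" by blast
  show "x \<otimes>\<^bsub>?W\<^esub> y \<in> ?S"
    using PiE_mem[OF f] PiE_mem[OF f' act_closed[OF _ subgroup.mem_carrier[OF B1 \<sigma>(1)]]]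
      subgroup.m_closed[OF B0] subgroup.m_closed[OF B1 \<sigma>] by simp
qed

text \<open>Factorise the top part as \<open>\<alpha> \<beta> \<gamma>\<close> and the coordinate \<open>f \<omega>\<^sub>1\<close> as \<open>a b c\<close>. Taking the base parts of
  the second and the third factor constant, with values \<open>b\<close> and \<open>c\<close>, removes all dependence on how
  \<open>\<alpha>\<close> and \<open>\<beta>\<close> move the coordinates. The base part of the first factor must then be
  \<open>f \<omega> (b c)\<^sup>-\<^sup>1\<close>, whose value at \<open>\<omega>\<^sub>1\<close> is \<open>a\<close> and whose other values are unconstrained.\<close>
lemma wreath_triple_factorisation:
  assumes T0: "triple_factorisation (G0, A0, B0)" and T1: "triple_factorisation (G1, A1, B1)"
    and fin: "finite \<Omega>" and \<omega>\<^sub>1: "\<omega>\<^sub>1 \<in> \<Omega>"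
    and fixes1: "\<forall>\<sigma>\<in>A1. \<sigma> \<omega>\<^sub>1 = \<omega>\<^sub>1"
  shows "triple_factorisation (wreath_triple \<Omega> \<omega>\<^sub>1 (G0, A0, B0) (G1, A1, B1))"
proof -
  let ?W = "wreath G0 \<Omega> G1"
  let ?A = "{(f, \<sigma>). f \<in> \<Omega> \<rightarrow>\<^sub>E carrier G0 \<and> f \<omega>\<^sub>1 \<in> A0 \<and> \<sigma> \<in> A1}"
  let ?B = "{(f, \<sigma>). f \<in> \<Omega> \<rightarrow>\<^sub>E B0 \<and> \<sigma> \<in> B1}"
  have A0: "subgroup A0 G0" and B0: "subgroup B0 G0" and A1: "subgroup A1 G1" and B1: "subgroup B1 G1"
    using T0 T1 by auto
  note A = point_subgroup[OF A0 A1 \<omega>\<^sub>1 fixes1] and B = wreath_subgroup[OF B0 B1]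
  note sub = subgroup.subset[OF A] subgroup.subset[OF B]
  have "x \<in> ?A <#>\<^bsub>?W\<^esub> ?B <#>\<^bsub>?W\<^esub> ?A" if x: "x \<in> carrier ?W" for x
  proof -
    obtain f \<sigma> where [simp]: "x = (f, \<sigma>)" and f: "f \<in> \<Omega> \<rightarrow>\<^sub>E carrier G0" and \<sigma>: "\<sigma> \<in> carrier G1"
      using x by (auto simp: wreath_carrier)
    have "f \<omega>\<^sub>1 \<in> A0 <#>\<^bsub>G0\<^esub> B0 <#>\<^bsub>G0\<^esub> A0" using PiE_mem[OF f \<omega>\<^sub>1] T0 by auto
    then obtain a b c where abc: "a \<in> A0" "b \<in> B0" "c \<in> A0" "f \<omega>\<^sub>1 = a \<otimes>\<^bsub>G0\<^esub> b \<otimes>\<^bsub>G0\<^esub> c"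
      by (auto simp: set_mult_def)
    have "\<sigma> \<in> A1 <#>\<^bsub>G1\<^esub> B1 <#>\<^bsub>G1\<^esub> A1" using \<sigma> T1 by auto
    then obtain \<alpha> \<beta> \<gamma> where \<alpha>\<beta>\<gamma>: "\<alpha> \<in> A1" "\<beta> \<in> B1" "\<gamma> \<in> A1" "\<sigma> = \<alpha> \<otimes>\<^bsub>G1\<^esub> \<beta> \<otimes>\<^bsub>G1\<^esub> \<gamma>"
      by (auto simp: set_mult_def)
    have mem: "a \<in> carrier G0" "b \<in> carrier G0" "c \<in> carrier G0"
      "\<alpha> \<in> carrier G1" "\<beta> \<in> carrier G1" "\<gamma> \<in> carrier G1"
      using abc \<alpha>\<beta>\<gamma> A0 B0 A1 B1 by (auto dest: subgroup.mem_carrier)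
    let ?f = "\<lambda>\<omega>\<in>\<Omega>. f \<omega> \<otimes>\<^bsub>G0\<^esub> inv\<^bsub>G0\<^esub> (b \<otimes>\<^bsub>G0\<^esub> c)"
    have 1: "(?f, \<alpha>) \<in> ?A"
      using PiE_mem[OF f] mem abc \<alpha>\<beta>\<gamma>(1) \<omega>\<^sub>1 by (auto simp: G0.m_assoc)
    have 2: "((\<lambda>\<omega>\<in>\<Omega>. b), \<beta>) \<in> ?B" and 3: "((\<lambda>\<omega>\<in>\<Omega>. c), \<gamma>) \<in> ?A"
      using abc \<alpha>\<beta>\<gamma> mem \<omega>\<^sub>1 by auto
    have "f = (\<lambda>\<omega>\<in>\<Omega>. f \<omega> \<otimes>\<^bsub>G0\<^esub> inv\<^bsub>G0\<^esub> (b \<otimes>\<^bsub>G0\<^esub> c) \<otimes>\<^bsub>G0\<^esub> b \<otimes>\<^bsub>G0\<^esub> c)"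
      by (rule extensionalityI[of _ \<Omega>]) (use f PiE_mem[OF f] mem in \<open>auto simp: G0.m_assoc PiE_iff\<close>)
    moreover have "\<alpha> \<omega> \<in> \<Omega>" "(\<alpha> \<otimes>\<^bsub>G1\<^esub> \<beta>) \<omega> \<in> \<Omega>" if "\<omega> \<in> \<Omega>" for \<omega>
      using act_closed[OF that mem(4)] act_closed[OF that m_closed[OF mem(4,5)]] by auto
    ultimately have "x = (?f, \<alpha>) \<otimes>\<^bsub>?W\<^esub> ((\<lambda>\<omega>\<in>\<Omega>. b), \<beta>) \<otimes>\<^bsub>?W\<^esub> ((\<lambda>\<omega>\<in>\<Omega>. c), \<gamma>)"
      using mem \<alpha>\<beta>\<gamma>(4) by (simp cong: restrict_cong)
    with 1 2 3 show ?thesis unfolding set_mult_def by blast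
  qed
  moreover have "?A <#>\<^bsub>?W\<^esub> ?B <#>\<^bsub>?W\<^esub> ?A \<subseteq> carrier ?W"
    using sub by (intro monoid.set_mult_closed[OF group.is_monoid[OF wreath_group]])
  ultimately have "carrier ?W = ?A <#>\<^bsub>?W\<^esub> ?B <#>\<^bsub>?W\<^esub> ?A" by blast
  moreover have "finite (carrier ?W)"
    using T0 T1 fin by (auto simp: wreath_carrier intro!: finite_PiE)
  ultimately show ?thesis
    using A B wreath_group by simp
qed

text \<open>Since the elements \<open>\<alpha>\<close> of \<open>A1\<close> fix \<open>\<omega>\<^sub>1\<close>, the coordinate \<open>\<omega>\<^sub>1\<close> of a product \<open>(f, \<alpha>) (f', \<beta>)\<close> is
  \<open>f \<omega>\<^sub>1 \<cdot> f' \<omega>\<^sub>1\<close>. So a factorisation of \<open>(\<lambda>_. g, \<sigma>)\<close> yields one of \<open>g\<close> and one of \<open>\<sigma>\<close>.\<close>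
lemma wreath_degenerate_imp:
  assumes A0: "subgroup A0 G0" and B0: "subgroup B0 G0" and A1: "subgroup A1 G1" and B1: "subgroup B1 G1"
    and \<omega>\<^sub>1: "\<omega>\<^sub>1 \<in> \<Omega>" and fixes1: "\<forall>\<sigma>\<in>A1. \<sigma> \<omega>\<^sub>1 = \<omega>\<^sub>1"
    and deg: "degenerate (wreath_triple \<Omega> \<omega>\<^sub>1 (G0, A0, B0) (G1, A1, B1))"
  shows "degenerate (G0, A0, B0)" "degenerate (G1, A1, B1)"
proof -
  have *: "g \<in> A0 <#>\<^bsub>G0\<^esub> B0 \<and> \<sigma> \<in> A1 <#>\<^bsub>G1\<^esub> B1" if "g \<in> carrier G0" "\<sigma> \<in> carrier G1" for g \<sigma>
  proof -
    have "((\<lambda>\<omega>\<in>\<Omega>. g), \<sigma>) \<in> carrier (wreath G0 \<Omega> G1)"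
      using that by (auto simp: wreath_carrier)
    then obtain f \<alpha> f' \<beta> where fac: "f \<omega>\<^sub>1 \<in> A0" "\<alpha> \<in> A1" "f' \<in> \<Omega> \<rightarrow>\<^sub>E B0" "\<beta> \<in> B1"
      "((\<lambda>\<omega>\<in>\<Omega>. g), \<sigma>) = (f, \<alpha>) \<otimes>\<^bsub>wreath G0 \<Omega> G1\<^esub> (f', \<beta>)"
      using deg by (auto simp: set_mult_def simp del: wreath_mult) 
    have \<alpha>: "\<alpha> \<omega>\<^sub>1 = \<omega>\<^sub>1" using fac(2) fixes1 by blast
    have "g = f \<omega>\<^sub>1 \<otimes>\<^bsub>G0\<^esub> f' \<omega>\<^sub>1" "\<sigma> = \<alpha> \<otimes>\<^bsub>G1\<^esub> \<beta>"
      using fac(5) \<omega>\<^sub>1 \<alpha> by (auto dest: fun_cong[of _ _ \<omega>\<^sub>1])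
    then show ?thesis
      using fac(1,2,4) PiE_mem[OF fac(3) \<omega>\<^sub>1] by (auto simp: set_mult_def)
  qed
  note closed = G0.set_mult_closed[OF subgroup.subset[OF A0] subgroup.subset[OF B0]]
    set_mult_closed[OF subgroup.subset[OF A1] subgroup.subset[OF B1]]
  show "degenerate (G0, A0, B0)" using *[OF _ one_closed] closed by auto
  show "degenerate (G1, A1, B1)" using *[OF G0.one_closed] closed by auto
qed

end

section \<open>The block system and the embedding\<close>

locale block_system = group G for G :: "'a monoid" (structure) +
  fixes A H :: "'a set"
  assumes A: "subgroup A G" and H: "subgroup H G" and AH: "A \<subseteq> H"
begin

lemma H_closed: "h \<in> H \<Longrightarrow> h \<in> carrier G"
  using subgroup.mem_carrier[OF H] .

lemma rcoset_subset: "h \<in> carrier G \<Longrightarrow> A #> h \<subseteq> carrier G"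
  using r_coset_subset_G[OF subgroup.subset[OF A]] .

lemma rcoset_eq_iff:
  assumes "g \<in> carrier G" "h \<in> carrier G"
  shows "A #> g = A #> h \<longleftrightarrow> g \<otimes> inv h \<in> A"
proof
  assume "A #> g = A #> h"
  then have "A #> (g \<otimes> inv h) = A"
    using assms by (metis A coset_mult_assoc coset_mult_one inv_closed r_inv subgroup.subset)
  then show "g \<otimes> inv h \<in> A"
    using assms coset_join1[OF _ _ A] by simp
next
  assume "g \<otimes> inv h \<in> A"
  then have "A #> (g \<otimes> inv h) = A"
    using assms A by (simp add: coset_join2)
  then have "A #> ((g \<otimes> inv h) \<otimes> h) = A #> h"
    using assms A by (metis coset_mult_assoc inv_closed m_closed subgroup.subset)
  then show "A #> g = A #> h"
    using assms by (simp add: m_assoc)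
qed

lemma rcoset_assoc:
  "g \<in> carrier G \<Longrightarrow> h \<in> carrier G \<Longrightarrow> (A #> g) #> h = A #> (g \<otimes> h)"
  using coset_mult_assoc[OF subgroup.subset[OF A]] .

lemma base_point: "A \<in> block G A H"
proof -
  have "A #> \<one> = A" using subgroup.subset[OF A] by simp
  then show ?thesis using subgroup.one_closed[OF H] unfolding block_def by force
qed

lemma translate_block:
  "g \<in> carrier G \<Longrightarrow> translate G (block G A H) g = (\<lambda>h. A #> (h \<otimes> g)) ` H"
  by (auto simp: translate_def block_def image_image rcoset_assoc H_closed)

lemma translate_block_mult:
  assumes "g \<in> carrier G" "h \<in> carrier G"
  shows "translate G (translate G (block G A H) g) h = translate G (block G A H) (g \<otimes> h)"
  using assms
  by (auto simp: translate_block m_assoc H_closed rcoset_assoc image_image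
      translate_def[of G "(\<lambda>h. A #> (h \<otimes> g)) ` H"])

lemma translate_block_one: "translate G (block G A H) \<one> = block G A H"
  using translate_block[OF one_closed] H_closed by (simp add: block_def cong: image_cong)

text \<open>This identifies \<open>H\<close> as the stabiliser of the block \<open>\<Delta>\<close>: an element that preserves \<open>\<Delta>\<close> sends the
  point \<open>A\<close> to some \<open>A h\<close> with \<open>h \<in> H\<close>, and so lies in \<open>A h \<subseteq> H\<close>.\<close>
lemma translate_block_eq_iff:
  assumes g: "g \<in> carrier G"
  shows "translate G (block G A H) g = block G A H \<longleftrightarrow> g \<in> H"
proof
  assume "translate G (block G A H) g = block G A H"
  then have "A #> g \<in> block G A H"
    using base_point by (auto simp: translate_def)
  then obtain h where h: "h \<in> H" "A #> g = A #> h"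
    by (auto simp: block_def)
  then have "g \<otimes> inv h \<in> H"
    using g rcoset_eq_iff H_closed AH by auto
  then have "(g \<otimes> inv h) \<otimes> h \<in> H"
    using h H by (simp add: subgroup.m_closed)
  then show "g \<in> H"
    using g h H_closed by (simp add: m_assoc)
next
  assume gH: "g \<in> H"
  have "(\<lambda>h. h \<otimes> g) ` H = H"
  proof
    show "H \<subseteq> (\<lambda>h. h \<otimes> g) ` H"
    proof
      fix h assume h: "h \<in> H"
      then have "h = (h \<otimes> inv g) \<otimes> g" using g H_closed by (simp add: m_assoc)
      then show "h \<in> (\<lambda>h. h \<otimes> g) ` H"
        using subgroup.m_closed[OF H h subgroup.m_inv_closed[OF H gH]] by (rule image_eqI)
    qed
  qed (use gH H in \<open>auto intro: subgroup.m_closed\<close>)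
  then have "(\<lambda>h. A #> (h \<otimes> g)) ` H = (\<lambda>h. A #> h) ` H"
    by (metis image_image)
  then show "translate G (block G A H) g = block G A H"
    using g by (simp add: translate_block) (simp add: block_def)
qed

lemma translate_block_eq_translate_iff:
  assumes g: "g \<in> carrier G" and h: "h \<in> carrier G"
  shows "translate G (block G A H) g = translate G (block G A H) h \<longleftrightarrow> g \<otimes> inv h \<in> H"
proof -
  have "translate G (block G A H) g = translate G (block G A H) h \<longleftrightarrow>
      translate G (block G A H) (g \<otimes> inv h) = block G A H"
    using g h translate_block_mult[of g "inv h"] translate_block_mult[of h "inv h"]
      translate_block_mult[of "g \<otimes> inv h" h] translate_block_one by (auto simp: m_assoc)
  then show ?thesis using g h translate_block_eq_iff by simp
qed

sublocale points: transitive_action "G\<lparr>carrier := H\<rparr>" "block G A H" "\<lambda>\<delta> x. \<delta> #> x" A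
proof (intro transitive_action.intro right_action.intro right_action_axioms.intro
    transitive_action_axioms.intro)
  show "group (G\<lparr>carrier := H\<rparr>)" by (rule subgroup_imp_group[OF H])
  have "A #> h #> g \<in> block G A H" if "h \<in> H" "g \<in> H" for h g
    using that H H_closed by (auto simp: block_def rcoset_assoc intro: subgroup.m_closed)
  then show "\<delta> #> g \<in> block G A H" if "\<delta> \<in> block G A H" "g \<in> carrier (G\<lparr>carrier := H\<rparr>)" for \<delta> g
    using that by (auto simp: block_def)
  show "\<delta> #> (g \<otimes>\<^bsub>G\<lparr>carrier := H\<rparr>\<^esub> h) = \<delta> #> g #> h"
    if "\<delta> \<in> block G A H" "g \<in> carrier (G\<lparr>carrier := H\<rparr>)" "h \<in> carrier (G\<lparr>carrier := H\<rparr>)" for \<delta> g h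
    using that H_closed rcoset_subset by (auto simp: block_def coset_mult_assoc)
  show "\<delta> #> \<one>\<^bsub>G\<lparr>carrier := H\<rparr>\<^esub> = \<delta>" if "\<delta> \<in> block G A H" for \<delta>
    using that H_closed rcoset_subset by (auto simp: block_def)
qed (use base_point in \<open>auto simp: block_def\<close>)

sublocale blocks: transitive_action G "blocks G A H" "translate G" "block G A H"
proof (intro transitive_action.intro right_action.intro right_action_axioms.intro
    transitive_action_axioms.intro is_group)
  show "block G A H \<in> blocks G A H"
    using translate_block_one unfolding blocks_def by (metis image_eqI one_closed)
qed (auto simp: blocks_def translate_block_mult m_assoc)

lemma points_stab: "points.stab = A"
  using AH H_closed coset_join1[OF _ _ A]
  by (auto simp: points.stab_def coset_join2 A)

lemma blocks_stab: "blocks.stab = H"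
  using H_closed translate_block_eq_iff by (auto simp: blocks.stab_def)

lemma points_perm: "points.perm = on_points G A H"
  by (simp add: fun_eq_iff points.perm_def on_points_def)

lemma blocks_perm: "blocks.perm = on_blocks G A H"
  by (simp add: fun_eq_iff blocks.perm_def on_blocks_def)

abbreviation point_group :: "('a set \<Rightarrow> 'a set) monoid" where
  "point_group \<equiv> perm_group (block G A H) (on_points G A H ` H)"

abbreviation block_group :: "('a set set \<Rightarrow> 'a set set) monoid" where
  "block_group \<equiv> perm_group (blocks G A H) (on_blocks G A H ` carrier G)"

lemma points_induced: "points.induced = point_group"
  by (simp add: points_perm)

lemma blocks_induced: "blocks.induced = block_group"
  by (simp add: blocks_perm)

lemma on_points_mult:
  "g \<in> H \<Longrightarrow> h \<in> H \<Longrightarrow> on_points G A H (g \<otimes> h) =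
     on_points G A H g \<otimes>\<^bsub>point_group\<^esub> on_points G A H h"
  using points.perm_mult[of g h] by (simp add: points_perm)

lemma on_blocks_mult:
  "g \<in> carrier G \<Longrightarrow> h \<in> carrier G \<Longrightarrow> on_blocks G A H (g \<otimes> h) =
     on_blocks G A H g \<otimes>\<^bsub>block_group\<^esub> on_blocks G A H h"
  using blocks.perm_mult[of g h] by (simp add: blocks_perm)

lemma on_points_mem_iff: "g \<in> H \<Longrightarrow> on_points G A H g \<in> on_points G A H ` A \<longleftrightarrow> g \<in> A"
  using points.perm_mem_perm_stab_iff[of g] by (simp add: points_perm points_stab)

lemma on_blocks_mem_iff:
  "g \<in> carrier G \<Longrightarrow> on_blocks G A H g \<in> on_blocks G A H ` H \<longleftrightarrow> g \<in> H"
  using blocks.perm_mem_perm_stab_iff[of g] by (simp add: blocks_perm blocks_stab)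

sublocale wreath: wreath_product point_group block_group "blocks G A H"
  using wreath_product.intro[OF points.induced_group blocks.induced_acts]
  unfolding points_induced blocks_induced .

end

locale block_embedding = block_system +
  fixes B :: "'a set" and t :: "'a set set \<Rightarrow> 'a"
  assumes B: "subgroup B G" and t: "transversal G A B H t"
begin

text \<open>The map \<open>(\<Gamma>, g) \<mapsto> t\<^sub>\<Gamma> g t\<^sub>\<Gamma>\<^sub>g\<^sup>-\<^sup>1\<close> of the Krasner--Kaloujnine embedding, taken in \<open>H\<close> before its
  values are made into permutations of \<open>\<Delta>\<close>.\<close>
definition cocycle :: "'a set set \<Rightarrow> 'a \<Rightarrow> 'a" where
  "cocycle \<Gamma> g = t \<Gamma> \<otimes> g \<otimes> inv (t (translate G \<Gamma> g))"

lemma t_closed: "\<Gamma> \<in> blocks G A H \<Longrightarrow> t \<Gamma> \<in> carrier G"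
  and translate_t: "\<Gamma> \<in> blocks G A H \<Longrightarrow> translate G (block G A H) (t \<Gamma>) = \<Gamma>"
  and t_block: "t (block G A H) = \<one>"
  using t by (auto simp: transversal_def)

text \<open>Both \<open>t\<^sub>\<Gamma> g\<close> and \<open>t\<^sub>\<Gamma>\<^sub>g\<close> take \<open>\<Delta>\<close> to \<open>\<Gamma>g\<close>, so they differ by an element of the stabiliser of \<open>\<Delta>\<close>.\<close>
lemma cocycle_mem:
  assumes "\<Gamma> \<in> blocks G A H" "g \<in> carrier G"
  shows "cocycle \<Gamma> g \<in> H"
proof -
  have \<Gamma>g: "translate G \<Gamma> g \<in> blocks G A H"
    using assms by (rule blocks.act_closed)
  have "translate G (block G A H) (t \<Gamma> \<otimes> g) = translate G (block G A H) (t (translate G \<Gamma> g))"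
    using assms \<Gamma>g by (simp add: translate_t t_closed flip: translate_block_mult)
  then show ?thesis
    using assms \<Gamma>g by (simp add: cocycle_def translate_block_eq_translate_iff t_closed)
qed

text \<open>The inner representatives cancel. This identity is the multiplication rule of the wreath product,
  and makes the embedding a homomorphism.\<close>
lemma cocycle_mult:
  assumes "\<Gamma> \<in> blocks G A H" "g \<in> carrier G" "h \<in> carrier G"
  shows "cocycle \<Gamma> (g \<otimes> h) = cocycle \<Gamma> g \<otimes> cocycle (translate G \<Gamma> g) h"
proof -
  define s where "s = t (translate G \<Gamma> g)"
  define u where "u = t (translate G \<Gamma> (g \<otimes> h))"
  have "s \<in> carrier G" "u \<in> carrier G" "t \<Gamma> \<in> carrier G"
    using assms by (auto simp: s_def u_def intro!: t_closed blocks.act_closed)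
  moreover have "u = t (translate G (translate G \<Gamma> g) h)"
    using assms by (simp add: u_def blocks.act_mult)
  moreover have "inv s \<otimes> (s \<otimes> x) = x" if "x \<in> carrier G" for x
    using that \<open>s \<in> carrier G\<close> by (simp flip: m_assoc)
  ultimately show ?thesis
    using assms by (simp add: cocycle_def m_assoc flip: s_def u_def)
qed

lemma cocycle_block: "h \<in> H \<Longrightarrow> cocycle (block G A H) h = h"
  using H_closed translate_block_eq_iff[of h] by (simp add: cocycle_def t_block)

lemma embedding_eq:
  "embedding G A H t g = ((\<lambda>\<Gamma>\<in>blocks G A H. on_points G A H (cocycle \<Gamma> g)), on_blocks G A H g)"
  by (simp add: embedding_def cocycle_def)

lemma embedding_hom: "embedding G A H t \<in> hom G (wreath point_group (blocks G A H) block_group)"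
proof (rule homI)
  fix g assume "g \<in> carrier G"
  then show "embedding G A H t g \<in> carrier (wreath point_group (blocks G A H) block_group)"
    using cocycle_mem by (auto simp: embedding_eq wreath.wreath_carrier)
next
  fix g h assume gh: "g \<in> carrier G" "h \<in> carrier G"
  have "on_points G A H (cocycle \<Gamma> (g \<otimes> h)) = on_points G A H (cocycle \<Gamma> g) \<otimes>\<^bsub>point_group\<^esub>
      on_points G A H (cocycle (on_blocks G A H g \<Gamma>) h)" if \<Gamma>: "\<Gamma> \<in> blocks G A H" for \<Gamma>
    using cocycle_mult[OF \<Gamma> gh] cocycle_mem[OF \<Gamma> gh(1)]
      cocycle_mem[OF blocks.act_closed[OF \<Gamma> gh(1)] gh(2)] \<Gamma>
    by (simp add: on_points_mult on_blocks_def del: perm_group_simps)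
  then show "embedding G A H t (g \<otimes> h) =
    embedding G A H t g \<otimes>\<^bsub>wreath point_group (blocks G A H) block_group\<^esub> embedding G A H t h"
    using gh
    by (auto simp: embedding_eq on_blocks_mult on_blocks_def[of _ _ _ g] blocks.act_closed
        simp del: perm_group_simps intro!: restrict_ext)
qed

text \<open>Given \<open>x\<close> in \<open>G\<close>, put \<open>\<Gamma> = \<Delta>x\<close> and write \<open>x = h t\<^sub>\<Gamma>\<close> with \<open>h \<in> H\<close>. If \<open>\<phi>(g) = 1\<close>, then \<open>g\<close> preserves
  \<open>\<Gamma>\<close> and \<open>t\<^sub>\<Gamma> g t\<^sub>\<Gamma>\<^sup>-\<^sup>1\<close> fixes every point of \<open>\<Delta>\<close>, in particular \<open>A h\<close>. This says that
  \<open>x g x\<^sup>-\<^sup>1\<close> lies in \<open>A\<close>; as \<open>x\<close> was arbitrary, \<open>g\<close> lies in the core.\<close>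
lemma embedding_eq_one_imp_mem_core:
  assumes g: "g \<in> carrier G"
    and one: "embedding G A H t g = \<one>\<^bsub>wreath point_group (blocks G A H) block_group\<^esub>"
  shows "g \<in> core G A"
proof -
  have "g \<in> {inv x \<otimes> a \<otimes> x | a. a \<in> A}" if x: "x \<in> carrier G" for x
  proof -
    define \<Gamma> where "\<Gamma> = translate G (block G A H) x"
    have \<Gamma>: "\<Gamma> \<in> blocks G A H" using x by (simp add: \<Gamma>_def blocks_def)
    define h where "h = x \<otimes> inv (t \<Gamma>)"
    have h: "h \<in> H"
      using x \<Gamma> translate_t[OF \<Gamma>] translate_block_eq_translate_iff[of x "t \<Gamma>"] t_closed
      by (simp add: h_def \<Gamma>_def)
    note mem = t_closed[OF \<Gamma>] H_closed[OF h]
    have x_eq: "x = h \<otimes> t \<Gamma>"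
      using x mem by (simp add: h_def m_assoc)
    have "on_blocks G A H g \<Gamma> = \<Gamma>" "on_points G A H (cocycle \<Gamma> g) = (\<lambda>\<delta>\<in>block G A H. \<delta>)"
    proof -
      have "on_blocks G A H g = (\<lambda>\<Gamma>\<in>blocks G A H. \<Gamma>)"
        and "(\<lambda>\<Gamma>\<in>blocks G A H. on_points G A H (cocycle \<Gamma> g)) =
          (\<lambda>\<Gamma>\<in>blocks G A H. \<lambda>\<delta>\<in>block G A H. \<delta>)"
        using one by (simp_all add: embedding_eq wreath.wreath_one)
      from this[THEN fun_cong, of \<Gamma>] show "on_blocks G A H g \<Gamma> = \<Gamma>"
        "on_points G A H (cocycle \<Gamma> g) = (\<lambda>\<delta>\<in>block G A H. \<delta>)"
        using \<Gamma> by simp_all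
    qed
    then have "translate G \<Gamma> g = \<Gamma>" and "on_points G A H (cocycle \<Gamma> g) (A #> h) = A #> h"
      using h \<Gamma> by (auto simp: on_blocks_def block_def)
    then have "A #> (h \<otimes> (t \<Gamma> \<otimes> g \<otimes> inv (t \<Gamma>))) = A #> h"
      using h mem g by (auto simp: on_points_def block_def cocycle_def rcoset_assoc)
    then have "h \<otimes> (t \<Gamma> \<otimes> g \<otimes> inv (t \<Gamma>)) \<otimes> inv h \<in> A"
      using rcoset_eq_iff mem g by simp
    moreover have "h \<otimes> (t \<Gamma> \<otimes> g \<otimes> inv (t \<Gamma>)) \<otimes> inv h = x \<otimes> g \<otimes> inv x"
      using mem g by (simp add: x_eq m_assoc inv_mult_group)
    moreover have "g = inv x \<otimes> (x \<otimes> g \<otimes> inv x) \<otimes> x"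
      using x g by (simp add: m_assoc) (simp flip: m_assoc)
    ultimately show ?thesis by auto
  qed
  then show ?thesis by (auto simp: core_def)
qed

lemma embedding_mon:
  assumes "core G A = {\<one>}"
  shows "embedding G A H t \<in> mon G (wreath point_group (blocks G A H) block_group)"
  unfolding mon_iff_hom_one[OF is_group wreath.wreath_group]
  using embedding_hom embedding_eq_one_imp_mem_core assms by blast

text \<open>The top part forces \<open>g\<close> into \<open>H\<close>, and then the coordinate \<open>\<Delta>\<close> of its image is the permutation
  induced by \<open>g\<close> itself, which lies in \<open>A\<^sub>0\<close> exactly when \<open>g\<close> fixes the point \<open>A\<close>.\<close>
lemma embedding_mem_base_iff:
  assumes g: "g \<in> carrier G"
  shows "embedding G A H t g \<in> {(f, \<sigma>). f \<in> blocks G A H \<rightarrow>\<^sub>E carrier point_group \<and>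
      f (block G A H) \<in> on_points G A H ` A \<and> \<sigma> \<in> on_blocks G A H ` H} \<longleftrightarrow> g \<in> A"
proof -
  have "(\<lambda>\<Gamma>\<in>blocks G A H. on_points G A H (cocycle \<Gamma> g)) \<in> blocks G A H \<rightarrow>\<^sub>E carrier point_group"
    using cocycle_mem g by auto
  then show ?thesis
    using blocks.base AH on_blocks_mem_iff[OF g] on_points_mem_iff[of g]
    by (auto simp: embedding_eq cocycle_block)
qed

text \<open>When all representatives lie in \<open>B\<close>, the values of the cocycle on \<open>B\<close> are products of elements
  of \<open>B\<close>; transitivity enters only to guarantee such representatives.\<close>
lemma embedding_mem_wreath_subgroup:
  assumes trans: "transitive_on (blocks G A H) (on_blocks G A H ` B)" and b: "b \<in> B"
  shows "embedding G A H t b \<in> {(f, \<sigma>). f \<in> blocks G A H \<rightarrow>\<^sub>E on_points G A H ` (B \<inter> H) \<and>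
    \<sigma> \<in> on_blocks G A H ` B}"
proof -
  have tB: "t \<Gamma> \<in> B" if "\<Gamma> \<in> blocks G A H" for \<Gamma>
    using t trans that by (simp add: transversal_def)
  have bG: "b \<in> carrier G" using b B by (rule subgroup.mem_carrier[rotated])
  have "cocycle \<Gamma> b \<in> B \<inter> H" if \<Gamma>: "\<Gamma> \<in> blocks G A H" for \<Gamma>
    using cocycle_mem[OF \<Gamma> bG] tB[OF \<Gamma>] tB[OF blocks.act_closed[OF \<Gamma> bG]] b B
    by (simp add: cocycle_def subgroup.m_closed subgroup.m_inv_closed)
  then show ?thesis using b by (auto simp: embedding_eq)
qed

lemma transitive_if_degenerate:
  assumes deg: "degenerate (G, H, B)"
  shows "transitive_on (blocks G A H) (on_blocks G A H ` B)"
proof -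
  have orbit: "\<exists>b\<in>B. \<Gamma> = translate G (block G A H) b" if \<Gamma>: "\<Gamma> \<in> blocks G A H" for \<Gamma>
  proof -
    obtain x where x: "x \<in> carrier G" "\<Gamma> = translate G (block G A H) x"
      using \<Gamma> by (auto simp: blocks_def)
    then obtain h b where hb: "h \<in> H" "b \<in> B" "x = h \<otimes> b"
      using deg by (auto simp: set_mult_def)
    then have "translate G (block G A H) x = translate G (block G A H) b"
      using H_closed subgroup.mem_carrier[OF B] translate_block_eq_iff[of h] translate_block_mult[of h b]
      by simp
    with x hb show ?thesis by blast
  qed
  have "\<exists>b\<in>B. on_blocks G A H b \<Gamma> = \<Gamma>'" if \<Gamma>: "\<Gamma> \<in> blocks G A H" and \<Gamma>': "\<Gamma>' \<in> blocks G A H" for \<Gamma> \<Gamma>'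
  proof -
    obtain b b' where b: "b \<in> B" "b' \<in> B" "\<Gamma> = translate G (block G A H) b"
      "\<Gamma>' = translate G (block G A H) b'"
      using orbit \<Gamma> \<Gamma>' by metis
    then have mem: "b \<in> carrier G" "b' \<in> carrier G" using subgroup.mem_carrier[OF B] by auto
    have "translate G \<Gamma> (inv b \<otimes> b') = \<Gamma>'"
      using mem b by (simp add: translate_block_mult) (simp flip: m_assoc)
    moreover have "inv b \<otimes> b' \<in> B"
      using b B by (simp add: subgroup.m_closed subgroup.m_inv_closed)
    ultimately show ?thesis using \<Gamma> by (auto simp: on_blocks_def)
  qed
  then show ?thesis by (auto simp: transitive_on_def)
qed

text \<open>If \<open>h \<in> H\<close> is a product \<open>a d\<close> with \<open>a \<in> A\<close> and \<open>d \<in> D\<close>, then \<open>d\<close> lies in \<open>H\<close>, so the coordinate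
  \<open>\<Delta>\<close> of its image is the permutation induced by \<open>d\<close>, and it belongs to \<open>B\<^sub>0\<close> by the definition of
  \<open>D\<close>. Thus \<open>G = A D\<close> projects to \<open>G\<^sub>0 = A\<^sub>0 B\<^sub>0\<close>.\<close>
lemma degenerate_lift_imp_degenerate_points:
  assumes D: "D = {g \<in> carrier G. embedding G A H t g \<in>
      {(f, \<sigma>). f \<in> blocks G A H \<rightarrow>\<^sub>E on_points G A H ` (B \<inter> H) \<and> \<sigma> \<in> on_blocks G A H ` B}}"
    and deg: "degenerate (G, A, D)"
  shows "degenerate (point_group, on_points G A H ` A, on_points G A H ` (B \<inter> H))"
proof -
  have "on_points G A H h \<in> on_points G A H ` A <#>\<^bsub>point_group\<^esub> on_points G A H ` (B \<inter> H)" if h: "h \<in> H" for h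
  proof -
    obtain a d where ad: "a \<in> A" "d \<in> D" "h = a \<otimes> d"
      using deg H_closed[OF h] by (auto simp: set_mult_def)
    then have mem: "a \<in> H" "d \<in> carrier G" using AH by (auto simp: D)
    have "inv a \<otimes> h = d" using ad mem H_closed by (simp flip: m_assoc)
    then have dH: "d \<in> H" using mem(1) h H by (metis subgroup.m_closed subgroup.m_inv_closed)
    have "on_points G A H (cocycle (block G A H) d) \<in> on_points G A H ` (B \<inter> H)"
      using ad(2) blocks.base by (auto simp: D embedding_eq dest!: PiE_mem)
    then have "on_points G A H d \<in> on_points G A H ` (B \<inter> H)"
      using dH by (simp add: cocycle_block)
    moreover have "on_points G A H h = on_points G A H a \<otimes>\<^bsub>point_group\<^esub> on_points G A H d"
      using on_points_mult ad mem dH by (simp del: perm_group_simps)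
    ultimately show ?thesis
      using ad(1) unfolding set_mult_def by blast
  qed
  moreover have "on_points G A H ` A <#>\<^bsub>point_group\<^esub> on_points G A H ` (B \<inter> H) \<subseteq> carrier point_group"
    using AH by (intro monoid.set_mult_closed[OF group.is_monoid[OF wreath.G0.is_group]])
      auto
  ultimately have "carrier point_group = on_points G A H ` A <#>\<^bsub>point_group\<^esub> on_points G A H ` (B \<inter> H)"
    unfolding perm_group_simps(1) by blast
  then show ?thesis unfolding degenerate.simps .
qed

end

section \<open>The decomposition theorem\<close>

theorem theorem1p2:
  fixes G :: "'a monoid" and A B H :: "'a set" and t :: "'a set set \<Rightarrow> 'a"
  assumes "nondegenerate (G, A, B)"
    and "core G A = {\<one>\<^bsub>G\<^esub>}"
    and "subgroup H G" and "A \<subset> H" and "H \<subset> carrier G"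
    and "transversal G A B H t"
  shows "let T = (G, A, B);
             T0 = triple0 G A B H;
             T1 = triple1 G A B H;
             TW = wreath_triple (blocks G A H) (block G A H) T0 T1;
             K0 = core (G\<lparr>carrier := H\<rparr>) A;
             K1 = core G H;
             \<phi> = embedding G A H t
         in \<phi> \<in> mon G (fst TW) \<and>
            triple_factorisation T0 \<and> triple_factorisation T1 \<and> triple_factorisation TW \<and>
            (\<exists>\<psi>. (\<forall>h\<in>H. \<psi> (K0 #>\<^bsub>G\<^esub> h) = on_points G A H h) \<and>
                 is_quotient_of \<psi> T0 (restrict_triple T H) K0) \<and>
            (\<exists>\<psi>. (\<forall>g\<in>carrier G. \<psi> (K1 #>\<^bsub>G\<^esub> g) = on_blocks G A H g) \<and>
                 lift_of (G, H, B) T \<and> is_quotient_of \<psi> T1 (G, H, B) K1) \<and>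
            nondegenerate TW \<and>
            (nondegenerate T1 \<or>
             nondegenerate T0 \<and> nondegenerate TW \<and>
             (\<exists>D. lift_of (G, A, D) T \<and> nondegenerate (G, A, D) \<and>
                  triple_iso \<phi> (G, A, D) (restrict_triple TW (\<phi> ` carrier G))))"
proof -
  have T: "triple_factorisation (G, A, B)" and nondeg: "\<not> degenerate (G, A, B)"
    using assms(1) unfolding nondegenerate_def by blast+
  have G: "group G" and fin: "finite (carrier G)" and A: "subgroup A G" and B: "subgroup B G"
    using T unfolding triple_factorisation.simps by blast+
  interpret block_embedding G A H B t
    using G A B assms(3,4,6)
    by (intro block_embedding.intro block_system.intro block_system_axioms.intro
        block_embedding_axioms.intro psubset_imp_subset)
  have H: "subgroup H G" by fact

  let ?\<Delta> = "block G A H" and ?\<Sigma> = "blocks G A H"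
  let ?A0 = "on_points G A H ` A" and ?B0 = "on_points G A H ` (B \<inter> H)"
  let ?A1 = "on_blocks G A H ` H" and ?B1 = "on_blocks G A H ` B"
  let ?W = "wreath point_group ?\<Sigma> block_group" and ?\<phi> = "embedding G A H t"
  define Ahat where "Ahat = {(f, \<sigma>). f \<in> ?\<Sigma> \<rightarrow>\<^sub>E carrier point_group \<and> f ?\<Delta> \<in> ?A0 \<and> \<sigma> \<in> ?A1}"
  define Bhat where "Bhat = {(f, \<sigma>). f \<in> ?\<Sigma> \<rightarrow>\<^sub>E ?B0 \<and> \<sigma> \<in> ?B1}"
  define TW where "TW = wreath_triple ?\<Sigma> ?\<Delta> (triple0 G A B H) (triple1 G A B H)"
  have TW_eq: "TW = (?W, Ahat, Bhat)"
    by (simp only: TW_def triple0_def triple1_def wreath_triple.simps Ahat_def Bhat_def)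

  have TH: "triple_factorisation (G\<lparr>carrier := H\<rparr>, A, B \<inter> H)"
    using triple_factorisation_restrict[OF T H AH] .
  have TL: "triple_factorisation (G, H, B)"
    using triple_factorisation_mono[OF T H AH B order_refl] .
  have T0: "triple_factorisation (triple0 G A B H)"
    using points.induced_triple_factorisation[of "B \<inter> H"] TH
    unfolding points_induced unfolding points_stab points_perm triple0_def by blast
  have T1: "triple_factorisation (triple1 G A B H)"
    using blocks.induced_triple_factorisation[of B] TL
    unfolding blocks_induced unfolding blocks_stab blocks_perm triple1_def by blast
  have deg0: "degenerate (G\<lparr>carrier := H\<rparr>, A, B \<inter> H)" if "degenerate (triple0 G A B H)"
    using points.induced_degenerate_imp_degenerate[of "B \<inter> H"] TH that
    unfolding points_induced unfolding points_stab points_perm triple0_def triple_factorisation.simps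
    by blast
  have deg1: "degenerate (G, H, B)" if "degenerate (triple1 G A B H)"
    using blocks.induced_degenerate_imp_degenerate[of B] B that
    unfolding blocks_induced unfolding blocks_stab blocks_perm triple1_def by blast
  \<comment> \<open>Both conclusions, the nondegeneracy of the wreath product and the dichotomy, come from here.\<close>
  have not_both: "\<not> degenerate (triple0 G A B H) \<or> \<not> degenerate (triple1 G A B H)"
    using degenerate_trans[OF G A B AH] deg0 deg1 nondeg by blast

  have quot0: "\<exists>\<psi>. (\<forall>h\<in>H. \<psi> (core (G\<lparr>carrier := H\<rparr>) A #>\<^bsub>G\<^esub> h) = on_points G A H h) \<and>
      is_quotient_of \<psi> (triple0 G A B H) (G\<lparr>carrier := H\<rparr>, A, B \<inter> H) (core (G\<lparr>carrier := H\<rparr>) A)"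
  proof -
    have "core (G\<lparr>carrier := H\<rparr>) A #>\<^bsub>G\<lparr>carrier := H\<rparr>\<^esub> h = core (G\<lparr>carrier := H\<rparr>) A #>\<^bsub>G\<^esub> h" for h
      by (simp add: r_coset_def)
    then show ?thesis
      using points.induced_is_quotient[of "B \<inter> H"] TH
      unfolding points_induced unfolding points_stab points_perm triple0_def by simp
  qed
  have quot1: "\<exists>\<psi>. (\<forall>g\<in>carrier G. \<psi> (core G H #>\<^bsub>G\<^esub> g) = on_blocks G A H g) \<and>
      is_quotient_of \<psi> (triple1 G A B H) (G, H, B) (core G H)"
    using blocks.induced_is_quotient[of B] TL
    unfolding blocks_induced unfolding blocks_stab blocks_perm triple1_def by blast

  have fixes1: "\<forall>\<sigma>\<in>?A1. \<sigma> ?\<Delta> = ?\<Delta>"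
    using blocks.base translate_block_eq_iff H_closed by (auto simp: on_blocks_def)
  have "finite ?\<Sigma>"
    using fin by (simp add: blocks_def)
  then have TFW: "triple_factorisation TW"
    using wreath.wreath_triple_factorisation[OF _ _ _ blocks.base fixes1] T0 T1
    unfolding TW_def triple0_def triple1_def by blast
  have sub: "subgroup ?A0 point_group" "subgroup ?B0 point_group"
    "subgroup ?A1 block_group" "subgroup ?B1 block_group"
    using T0 T1 by (auto simp: triple0_def triple1_def)
  have "\<not> degenerate TW"
    using wreath.wreath_degenerate_imp[OF sub blocks.base fixes1] not_both
    unfolding TW_def triple0_def triple1_def by blast
  with TFW have nondegW: "nondegenerate TW"
    unfolding nondegenerate_def by blast
  have mon: "?\<phi> \<in> mon G ?W"
    using embedding_mon assms(2) .

  have cases: "nondegenerate (triple1 G A B H) \<or>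
      nondegenerate (triple0 G A B H) \<and>
      (\<exists>D. lift_of (G, A, D) (G, A, B) \<and> nondegenerate (G, A, D) \<and>
           triple_iso ?\<phi> (G, A, D) (restrict_triple TW (?\<phi> ` carrier G)))"
  proof (cases "degenerate (triple1 G A B H)")
    case False
    with T1 show ?thesis unfolding nondegenerate_def by blast
  next
    case True
    with not_both have nondeg0: "\<not> degenerate (triple0 G A B H)" by blast
    define D where "D = {g \<in> carrier G. ?\<phi> g \<in> Bhat}"
    have Bhat: "subgroup Bhat ?W"
      unfolding Bhat_def by (rule wreath.wreath_subgroup[OF sub(2,4)])
    have "group_hom G ?W ?\<phi>"
      using G wreath.wreath_group embedding_hom by (simp add: group_hom_def group_hom_axioms_def)
    then have D: "subgroup D G"
      unfolding D_def using group_hom.subgroup_preimage Bhat by blast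
    have BD: "B \<subseteq> D"
    proof
      fix b assume b: "b \<in> B"
      then have "?\<phi> b \<in> Bhat"
        unfolding Bhat_def
        by (rule embedding_mem_wreath_subgroup[OF transitive_if_degenerate[OF deg1[OF True]]])
      with subgroup.mem_carrier[OF B b] show "b \<in> D"
        by (simp add: D_def)
    qed
    have TD: "triple_factorisation (G, A, D)"
      using triple_factorisation_mono[OF T A order_refl D BD] .
    have "\<not> degenerate (G, A, D)"
      using degenerate_lift_imp_degenerate_points[OF D_def[unfolded Bhat_def]] nondeg0 unfolding triple0_def by blast
    with TD have "nondegenerate (G, A, D)"
      unfolding nondegenerate_def by blast
    moreover have "lift_of (G, A, D) (G, A, B)"
      using T TD BD unfolding lift_of.simps by blast
    moreover have "triple_iso ?\<phi> (G, A, D) (restrict_triple TW (?\<phi> ` carrier G))"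
    proof -
      have "?\<phi> \<in> iso G (?W\<lparr>carrier := ?\<phi> ` carrier G\<rparr>)"
        using mon by (auto simp: iso_def mon_def hom_def bij_betw_def)
      moreover have "?\<phi> ` A = Ahat \<inter> ?\<phi> ` carrier G"
      proof -
        have "?\<phi> g \<in> Ahat \<longleftrightarrow> g \<in> A" if "g \<in> carrier G" for g
          unfolding Ahat_def by (rule embedding_mem_base_iff[OF that])
        then show ?thesis
          using subgroup.mem_carrier[OF A] by blast
      qed
      moreover have "?\<phi> ` D = Bhat \<inter> ?\<phi> ` carrier G"
        unfolding D_def by blast
      ultimately show ?thesis
        unfolding TW_eq restrict_triple.simps triple_iso.simps by blast
    qed
    ultimately show ?thesis
      using T0 nondeg0 unfolding nondegenerate_def by blast
  qed

  have restrict: "restrict_triple (G, A, B) H = (G\<lparr>carrier := H\<rparr>, A, B \<inter> H)"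
    using AH by (simp add: Int_absorb2)
  have lift: "lift_of (G, H, B) (G, A, B)"
    using T TL AH unfolding lift_of.simps by blast
  have mon': "?\<phi> \<in> mon G (fst TW)"
    using mon by (simp only: TW_eq fst_conv)
  show ?thesis
    unfolding Let_def restrict TW_def[symmetric]
    using mon' T0 T1 TFW quot0 quot1 lift nondegW cases by blast
qed

end
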